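(* The pseudovariety $\mathsf{NT}$ of all finite Neumann--Taylor semigroups has infinite rank and, therefore, it is non-finitely based (i.e. it admits no finite basis of pseudoidentities).
   Context: A pseudovariety of semigroups is a class of finite semigroups closed under taking subsemigroups, homomorphic images and finite direct products. For a semigroup $S$, $S^1=S$ if $S$ has an identity element, and otherwise $S^1=S\cup\{1\}$ is obtained by adjoining an identity $1$. For elements $x,y\in S$ and $z_1,z_2,\ldots\in S^1$ define recursively $\lambda_0=x$, $\rho_0=y$, $\lambda_{n+1}=\lambda_n z_{n+1}\rho_n$, $\rho_{n+1}=\rho_n z_{n+1}\lambda_n$, and write $\lambda_n=\lambda_n(x,y,z_1,\ldots,z_n)$, $\rho_n=\rho_n(x,y,z_1,\ldots,z_n)$. A semigroup $S$ is Neumann--Taylor if there is $n\ge 2$ such that $\lambda_n(a,b,1,c_2,\ldots,c_n)=\rho_n(a,b,1,c_2,\ldots,c_n)$ for all $a,b\in S$ and all $c_2,\ldots,c_n\in S^1$. $\mathsf{NT}$ is the class of all finite Neumann--Taylor semigroups; it is a pseudovariety. A semigroup is $n$-generated if it is generated by some subset with at most $n$ elements. A pseudovariety $\mathsf V$ has rank at most $n$ if, whenever a finite semigroup $S$ is such that all its $n$-generated subsemigroups belong to $\mathsf V$, also $S\in\mathsf V$. If there is no integer $n\ge 0$ such that $\mathsf V$ has rank at most $n$, then $\mathsf V$ has infinite rank. A pseudoidentity is a formal equality $\pi=\rho$ between elements $\pi,\rho$ of a free profinite semigroup on a finite set $\{x_1,\ldots,x_r\}$; a finite semigroup $S$ satisfies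 it if $\varphi(\pi)=\varphi(\rho)$ for every continuous homomorphism $\varphi$ from that free profinite semigroup to $S$ (discrete topology). A basis of pseudoidentities of a pseudovariety $\mathsf V$ is a set $\Sigma$ of pseudoidentities such that $\mathsf V$ is exactly the class of all finite semigroups satisfying all members of $\Sigma$. $\mathsf V$ is finitely based if it has a finite basis. *)

theory Defs
  imports "HOL-Analysis.Analysis" "HOL-Algebra.Congruence"
begin

section \<open>Semigroups with explicit carriers\<close>

record 'a semigrp = "'a partial_object" +
  sgmult :: "'a \<Rightarrow> 'a \<Rightarrow> 'a" (infixl \<open>\<cdot>\<index>\<close> 70)

text \<open>
  The empty semigroup is allowed. It satisfies every pseudoidentity and is Neumann--Taylor, so
  none of the notions below depends on this convention.
\<close>

definition is_semigroup :: "'a semigrp \<Rightarrow> bool" where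
  "is_semigroup S \<longleftrightarrow>
     (\<forall>a\<in>carrier S. \<forall>b\<in>carrier S. a \<cdot>\<^bsub>S\<^esub> b \<in> carrier S) \<and>
     (\<forall>a\<in>carrier S. \<forall>b\<in>carrier S. \<forall>c\<in>carrier S.
        (a \<cdot>\<^bsub>S\<^esub> b) \<cdot>\<^bsub>S\<^esub> c = a \<cdot>\<^bsub>S\<^esub> (b \<cdot>\<^bsub>S\<^esub> c))"

definition finite_semigroup :: "'a semigrp \<Rightarrow> bool" where
  "finite_semigroup S \<longleftrightarrow> is_semigroup S \<and> finite (carrier S)"

definition is_subsemigroup :: "'a set \<Rightarrow> 'a semigrp \<Rightarrow> bool" where
  "is_subsemigroup T S \<longleftrightarrow> T \<subseteq> carrier S \<and> (\<forall>a\<in>T. \<forall>b\<in>T. a \<cdot>\<^bsub>S\<^esub> b \<in> T)"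

inductive_set sg_generated :: "'a semigrp \<Rightarrow> 'a set \<Rightarrow> 'a set" for S A where
  incl: "a \<in> A \<Longrightarrow> a \<in> sg_generated S A"
| mult: "\<lbrakk>a \<in> sg_generated S A; b \<in> sg_generated S A\<rbrakk> \<Longrightarrow> a \<cdot>\<^bsub>S\<^esub> b \<in> sg_generated S A"

definition n_generated :: "nat \<Rightarrow> 'a semigrp \<Rightarrow> bool" where
  "n_generated n S \<longleftrightarrow>
     (\<exists>A. A \<subseteq> carrier S \<and> finite A \<and> card A \<le> n \<and> sg_generated S A = carrier S)"

definition is_sg_hom :: "('a \<Rightarrow> 'b) \<Rightarrow> 'a semigrp \<Rightarrow> 'b semigrp \<Rightarrow> bool" where
  "is_sg_hom f S T \<longleftrightarrow>
     (\<forall>a\<in>carrier S. f a \<in> carrier T) \<and>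
     (\<forall>a\<in>carrier S. \<forall>b\<in>carrier S. f (a \<cdot>\<^bsub>S\<^esub> b) = f a \<cdot>\<^bsub>T\<^esub> f b)"


section \<open>Adjoining an identity\<close>

definition is_identity :: "'a semigrp \<Rightarrow> 'a \<Rightarrow> bool" where
  "is_identity S e \<longleftrightarrow> e \<in> carrier S \<and> (\<forall>a\<in>carrier S. e \<cdot>\<^bsub>S\<^esub> a = a \<and> a \<cdot>\<^bsub>S\<^esub> e = a)"

text \<open>
  \<open>S\<^sup>1\<close> lives on the option type: \<open>S\<close> is embedded by \<open>Some\<close>, and \<open>None\<close> belongs to the carrier
  only if \<open>S\<close> has no identity of its own.
\<close>

fun opt_mult :: "('a \<Rightarrow> 'a \<Rightarrow> 'a) \<Rightarrow> 'a option \<Rightarrow> 'a option \<Rightarrow> 'a option" where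
  "opt_mult f None y = y"
| "opt_mult f (Some a) None = Some a"
| "opt_mult f (Some a) (Some b) = Some (f a b)"

definition adjoin_one :: "'a semigrp \<Rightarrow> 'a option semigrp" where
  "adjoin_one S =
     \<lparr>carrier = (if \<exists>e. is_identity S e then Some ` carrier S else insert None (Some ` carrier S)),
      sgmult = opt_mult (sgmult S)\<rparr>"

definition adjoined_one :: "'a semigrp \<Rightarrow> 'a option" where
  "adjoined_one S =
     (if \<exists>e. is_identity S e then Some (THE e. is_identity S e) else None)"


section \<open>Neumann--Taylor semigroups\<close>

text \<open>
  The elements \<open>\<lambda>\<^sub>n(x, y, z\<^sub>1, \<dots>, z\<^sub>n)\<close> and \<open>\<rho>\<^sub>n(x, y, z\<^sub>1, \<dots>, z\<^sub>n)\<close>, computed in \<open>M\<close>.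
  The parameters are passed as a sequence \<open>z\<close>, of which only \<open>z 1, \<dots>, z n\<close> are used.
\<close>

fun nt_lambda :: "'a semigrp \<Rightarrow> 'a \<Rightarrow> 'a \<Rightarrow> (nat \<Rightarrow> 'a) \<Rightarrow> nat \<Rightarrow> 'a"
  and nt_rho :: "'a semigrp \<Rightarrow> 'a \<Rightarrow> 'a \<Rightarrow> (nat \<Rightarrow> 'a) \<Rightarrow> nat \<Rightarrow> 'a" where
  "nt_lambda M x y z 0 = x"
| "nt_rho M x y z 0 = y"
| "nt_lambda M x y z (Suc n) = nt_lambda M x y z n \<cdot>\<^bsub>M\<^esub> z (Suc n) \<cdot>\<^bsub>M\<^esub> nt_rho M x y z n"
| "nt_rho M x y z (Suc n) = nt_rho M x y z n \<cdot>\<^bsub>M\<^esub> z (Suc n) \<cdot>\<^bsub>M\<^esub> nt_lambda M x y z n"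

definition neumann_taylor :: "'a semigrp \<Rightarrow> bool" where
  "neumann_taylor S \<longleftrightarrow>
     (\<exists>n\<ge>2. \<forall>a\<in>carrier S. \<forall>b\<in>carrier S. \<forall>c.
        c 1 = adjoined_one S \<and> (\<forall>i\<in>{2..n}. c i \<in> carrier (adjoin_one S)) \<longrightarrow>
        nt_lambda (adjoin_one S) (Some a) (Some b) c n =
        nt_rho (adjoin_one S) (Some a) (Some b) c n)"

definition NT :: "'a semigrp set" where
  "NT = {S. finite_semigroup S \<and> neumann_taylor S}"


section \<open>Rank\<close>

text \<open>
  A class of finite semigroups is a set of semigroups with carriers in a fixed type. Over an
  infinite type such as \<^typ>\<open>nat\<close> every finite semigroup occurs up to isomorphism.
\<close>

definition rank_at_most :: "nat \<Rightarrow> 'a semigrp set \<Rightarrow> bool" where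
  "rank_at_most n V \<longleftrightarrow>
     (\<forall>S. finite_semigroup S \<and>
        (\<forall>T. is_subsemigroup T S \<and> n_generated n (S\<lparr>carrier := T\<rparr>) \<longrightarrow> S\<lparr>carrier := T\<rparr> \<in> V)
        \<longrightarrow> S \<in> V)"

definition infinite_rank :: "'a semigrp set \<Rightarrow> bool" where
  "infinite_rank V \<longleftrightarrow> \<not> (\<exists>n. rank_at_most n V)"


section \<open>Free profinite semigroups\<close>

definition congruence_on :: "'a semigrp \<Rightarrow> 'a rel \<Rightarrow> bool" where
  "congruence_on S R \<longleftrightarrow> equiv (carrier S) R \<and>
     (\<forall>(a, b)\<in>R. \<forall>(c, d)\<in>R. (a \<cdot>\<^bsub>S\<^esub> c, b \<cdot>\<^bsub>S\<^esub> d) \<in> R)"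

definition finite_congruences :: "'a semigrp \<Rightarrow> 'a rel set" where
  "finite_congruences S = {R. congruence_on S R \<and> finite (carrier S // R)}"

text \<open>
  The projective limit of the finite quotients \<open>S/R\<close>: the families of classes compatible with the
  canonical maps \<open>S/R \<rightarrow> S/R'\<close> for \<open>R \<subseteq> R'\<close>, each of which sends a class to the unique class
  containing it. The union in the multiplication is the product of two classes in \<open>S/R\<close>.
\<close>

definition profinite_completion :: "'a semigrp \<Rightarrow> ('a rel \<Rightarrow> 'a set) semigrp" where
  "profinite_completion S =
     \<lparr>carrier = {p \<in> Pi\<^sub>E (finite_congruences S) (\<lambda>R. carrier S // R).
        \<forall>R\<in>finite_congruences S. \<forall>R'\<in>finite_congruences S. R \<subseteq> R' \<longrightarrow> p R \<subseteq> p R'},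
      sgmult = (\<lambda>p q. \<lambda>R\<in>finite_congruences S. \<Union>a\<in>p R. \<Union>b\<in>q R. R `` {a \<cdot>\<^bsub>S\<^esub> b})\<rparr>"

definition profinite_topology :: "'a semigrp \<Rightarrow> ('a rel \<Rightarrow> 'a set) topology" where
  "profinite_topology S =
     subtopology
       (product_topology (\<lambda>R. discrete_topology (carrier S // R)) (finite_congruences S))
       (carrier (profinite_completion S))"

text \<open>The generators \<open>x\<^sub>1, \<dots>, x\<^sub>r\<close> are represented by the numbers \<open>1, \<dots>, r\<close>.\<close>

definition free_semigroup :: "nat \<Rightarrow> nat list semigrp" where
  "free_semigroup r = \<lparr>carrier = lists {1..r} - {[]}, sgmult = (@)\<rparr>"

type_synonym implicit_op = "nat list rel \<Rightarrow> nat list set"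

definition free_profinite :: "nat \<Rightarrow> implicit_op semigrp" where
  "free_profinite r = profinite_completion (free_semigroup r)"

definition free_profinite_topology :: "nat \<Rightarrow> implicit_op topology" where
  "free_profinite_topology r = profinite_topology (free_semigroup r)"


section \<open>Pseudoidentities and bases\<close>

text \<open>The triple \<open>(r, p, q)\<close> stands for the formal equality \<open>p = q\<close> over \<open>x\<^sub>1, \<dots>, x\<^sub>r\<close>.\<close>

type_synonym pseudoidentity = "nat \<times> implicit_op \<times> implicit_op"

definition is_pseudoidentity :: "pseudoidentity \<Rightarrow> bool" where
  "is_pseudoidentity = (\<lambda>(r, p, q). p \<in> carrier (free_profinite r) \<and> q \<in> carrier (free_profinite r))"

definition satisfies :: "'a semigrp \<Rightarrow> pseudoidentity \<Rightarrow> bool" where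
  "satisfies S = (\<lambda>(r, p, q).
     \<forall>\<phi>. is_sg_hom \<phi> (free_profinite r) S \<and>
         continuous_map (free_profinite_topology r) (discrete_topology (carrier S)) \<phi> \<longrightarrow>
         \<phi> p = \<phi> q)"

definition is_basis :: "pseudoidentity set \<Rightarrow> 'a semigrp set \<Rightarrow> bool" where
  "is_basis \<Sigma> V \<longleftrightarrow> (\<forall>e\<in>\<Sigma>. is_pseudoidentity e) \<and>
     V = {S. finite_semigroup S \<and> (\<forall>e\<in>\<Sigma>. satisfies S e)}"

definition finitely_based :: "'a semigrp set \<Rightarrow> bool" where
  "finitely_based V \<longleftrightarrow> (\<exists>\<Sigma>. finite \<Sigma> \<and> is_basis \<Sigma> V)"

end

theory Submission
  imports Defs
begin

text \<open>
  Take a graph with two disjoint paths labelled by the words \<open>\<lambda>\<close> and \<open>\<rho>\<close> of level \<open>d + 2\<close> in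
  free letters, and two further letters leading from the ends of the paths back to their starts,
  one switching the paths and the other not. Let \<open>S\<close> be the semigroup of the relations between
  vertices that are induced by nonempty words. Reading the parameters in order and then alternating
  the two additional letters keeps \<open>\<lambda>\<^sub>n\<close> and \<open>\<rho>\<^sub>n\<close> apart for ever. Conversely, a word that can be read
  from two vertices is short, so if \<open>\<lambda>\<^sub>n\<close> and \<open>\<rho>\<^sub>n\<close> differ for large \<open>n\<close>, they are eventually
  single pairs that cycle between the starts and the ends of the paths. Going back in time from
  there, the words on the two paths can be decomposed in only one way, so all of the \<open>d + 1\<close>
  parameters have been used. These are irreducible in \<open>S\<close>, hence a \<open>d\<close>-generated subsemigroup lacks
  one of them and is Neumann--Taylor. A finite basis, on the other hand, bounds the rank by the
  number of its variables, because the free semigroup is dense in the free profinite semigroup.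
\<close>

section \<open>Finitely based classes have finite rank\<close>

lemma sg_generated_carrier [simp]: "sg_generated (S\<lparr>carrier := T\<rparr>) A = sg_generated S A"
proof (intro equalityI subsetI)
  show "x \<in> sg_generated S A" if "x \<in> sg_generated (S\<lparr>carrier := T\<rparr>) A" for x
    using that by induction (auto intro: sg_generated.intros)
  show "x \<in> sg_generated (S\<lparr>carrier := T\<rparr>) A" if "x \<in> sg_generated S A" for x
    using that
  proof induction
    case (mult a b)
    then show ?case using sg_generated.mult[of a "S\<lparr>carrier := T\<rparr>" A b] by simp
  qed (rule sg_generated.incl)
qed

section \<open>Density of a semigroup in its profinite completion\<close>

lemma total_finite_congruence:
  assumes "is_semigroup G"
  shows "carrier G \<times> carrier G \<in> finite_congruences G"
proof -
  have "equiv (carrier G) (carrier G \<times> carrier G)"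
    by (rule equivI) (auto intro: symI transI refl_onI)
  moreover have "carrier G // (carrier G \<times> carrier G) \<subseteq> {carrier G}"
    by (auto simp: quotient_def)
  then have "finite (carrier G // (carrier G \<times> carrier G))" by (rule finite_subset) simp
  ultimately show ?thesis
    using assms unfolding finite_congruences_def congruence_on_def is_semigroup_def by auto
qed

lemma finite_congruence_Int:
  assumes "R \<in> finite_congruences G" "R' \<in> finite_congruences G"
  shows "R \<inter> R' \<in> finite_congruences G"
proof -
  have e: "equiv (carrier G) R" "equiv (carrier G) R'"
    using assms unfolding finite_congruences_def congruence_on_def by auto
  have "equiv (carrier G) (R \<inter> R')"
    using e by (auto simp: equiv_def refl_on_def sym_Int trans_Int)
  moreover have "carrier G // (R \<inter> R') \<subseteq> (\<lambda>(C, D). C \<inter> D) ` (carrier G // R \<times> carrier G // R')"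
  proof
    fix C assume "C \<in> carrier G // (R \<inter> R')"
    then obtain x where x: "x \<in> carrier G" "C = (R \<inter> R') `` {x}" by (auto elim: quotientE)
    then have "C = R `` {x} \<inter> R' `` {x}" by auto
    moreover have "R `` {x} \<in> carrier G // R" "R' `` {x} \<in> carrier G // R'"
      using x(1) by (auto intro: quotientI)
    ultimately show "C \<in> (\<lambda>(C, D). C \<inter> D) ` (carrier G // R \<times> carrier G // R')" by auto
  qed
  then have "finite (carrier G // (R \<inter> R'))"
    by (rule finite_subset) (use assms in \<open>auto simp: finite_congruences_def\<close>)
  moreover have "\<forall>(a, b)\<in>R \<inter> R'. \<forall>(c, d)\<in>R \<inter> R'. (a \<cdot>\<^bsub>G\<^esub> c, b \<cdot>\<^bsub>G\<^esub> d) \<in> R \<inter> R'"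
    using assms unfolding finite_congruences_def congruence_on_def by blast
  ultimately show ?thesis unfolding finite_congruences_def congruence_on_def by simp
qed

text \<open>Finite congruences are closed under intersection, so \<open>F\<close> has a common
  refinement \<open>R0\<close>. Any element of the class \<open>p R0\<close> serves as
  \<open>w\<close>, because compatibility gives \<open>p R0 \<subseteq> p R\<close>.\<close>

lemma profinite_completion_approx:
  assumes G: "is_semigroup G" and p: "p \<in> carrier (profinite_completion G)"
    and F: "finite F" "F \<subseteq> finite_congruences G"
  obtains w where "w \<in> carrier G" "\<And>R. R \<in> F \<Longrightarrow> p R = R `` {w}"
proof -
  have "\<exists>R0\<in>finite_congruences G. \<forall>R\<in>F. R0 \<subseteq> R"
    using F
  proof (induction F)
    case empty
    then show ?case using total_finite_congruence[OF G] by auto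
  next
    case (insert R F)
    then obtain R0 where "R0 \<in> finite_congruences G" "\<forall>R\<in>F. R0 \<subseteq> R" by auto
    moreover from this insert.prems have "R \<inter> R0 \<in> finite_congruences G"
      by (intro finite_congruence_Int) simp_all
    ultimately show ?case by (intro bexI[of _ "R \<inter> R0"]) auto
  qed
  then obtain R0 where R0: "R0 \<in> finite_congruences G" "\<And>R. R \<in> F \<Longrightarrow> R0 \<subseteq> R" by blast
  have quot: "p R \<in> carrier G // R" if "R \<in> finite_congruences G" for R
    using p that unfolding profinite_completion_def by auto
  have eq: "equiv (carrier G) R" if "R \<in> finite_congruences G" for R
    using that unfolding finite_congruences_def congruence_on_def by auto
  obtain w where w: "w \<in> p R0"
    using in_quotient_imp_non_empty[OF eq[OF R0(1)] quot[OF R0(1)]] by blast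
  have "w \<in> carrier G"
    using w in_quotient_imp_subset[OF eq[OF R0(1)] quot[OF R0(1)]] by blast
  moreover have "p R = R `` {w}" if "R \<in> F" for R
  proof -
    have R: "R \<in> finite_congruences G" using that F by blast
    then have "p R0 \<subseteq> p R"
      using p R0(1) R0(2)[OF that] unfolding profinite_completion_def by simp
    then have "w \<in> p R" using w by blast
    moreover obtain x where x: "p R = R `` {x}" using quot[OF R] by (rule quotientE)
    ultimately have "(x, w) \<in> R" by simp
    then show ?thesis unfolding x by (rule equiv_class_eq[OF eq[OF R]])
  qed
  ultimately show ?thesis using that by blast
qed

definition to_completion :: "'a semigrp \<Rightarrow> 'a \<Rightarrow> 'a rel \<Rightarrow> 'a set" where
  "to_completion G w = (\<lambda>R\<in>finite_congruences G. R `` {w})"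

lemma to_completion_carrier:
  "w \<in> carrier G \<Longrightarrow> to_completion G w \<in> carrier (profinite_completion G)"
  by (auto simp: to_completion_def profinite_completion_def intro: quotientI)

lemma to_completion_mult:
  assumes "is_semigroup G" "u \<in> carrier G" "v \<in> carrier G"
  shows "to_completion G (u \<cdot>\<^bsub>G\<^esub> v) =
    to_completion G u \<cdot>\<^bsub>profinite_completion G\<^esub> to_completion G v"
proof -
  have classes: "(\<Union>a\<in>R `` {u}. \<Union>b\<in>R `` {v}. R `` {a \<cdot>\<^bsub>G\<^esub> b}) = R `` {u \<cdot>\<^bsub>G\<^esub> v}"
    if R: "R \<in> finite_congruences G" for R
  proof -
    have e: "equiv (carrier G) R"
      and c: "\<And>a b c d. (a, b) \<in> R \<Longrightarrow> (c, d) \<in> R \<Longrightarrow> (a \<cdot>\<^bsub>G\<^esub> c, b \<cdot>\<^bsub>G\<^esub> d) \<in> R"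
      using R unfolding finite_congruences_def congruence_on_def by auto
    have "R `` {a \<cdot>\<^bsub>G\<^esub> b} = R `` {u \<cdot>\<^bsub>G\<^esub> v}" if "a \<in> R `` {u}" "b \<in> R `` {v}" for a b
      using equiv_class_eq[OF e c[of u a v b]] that by auto
    moreover have "u \<in> R `` {u}" "v \<in> R `` {v}"
      using equiv_class_self[OF e] assms(2,3) by blast+
    ultimately show ?thesis by blast
  qed
  show ?thesis
  proof (rule ext)
    fix R
    show "to_completion G (u \<cdot>\<^bsub>G\<^esub> v) R =
      (to_completion G u \<cdot>\<^bsub>profinite_completion G\<^esub> to_completion G v) R"
      using classes[of R]
      by (cases "R \<in> finite_congruences G") (simp_all add: to_completion_def profinite_completion_def)
  qed
qed

lemma topspace_profinite_topology:
  "topspace (profinite_topology G) = carrier (profinite_completion G)"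
  by (auto simp: profinite_topology_def profinite_completion_def)

text \<open>As the target is discrete, the points with the same image as \<open>p\<close> form an
  open set. A basic neighbourhood of \<open>p\<close> inside it restricts only finitely many
  coordinates, so \<open>profinite_completion_approx\<close> finds an element of \<open>G\<close>
  there.\<close>

lemma continuous_map_completion_dense:
  assumes G: "is_semigroup G" and p: "p \<in> carrier (profinite_completion G)"
    and cont: "continuous_map (profinite_topology G) (discrete_topology C) \<phi>"
  shows "\<exists>w\<in>carrier G. \<phi> p = \<phi> (to_completion G w)"
proof -
  let ?X = "\<lambda>R. discrete_topology (carrier G // R)" and ?I = "finite_congruences G"
  have "\<phi> p \<in> C"
    using cont p topspace_profinite_topology[of G] unfolding continuous_map_def by auto
  then have "openin (profinite_topology G) {x \<in> topspace (profinite_topology G). \<phi> x \<in> {\<phi> p}}"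
    using cont unfolding continuous_map_def openin_discrete_topology by blast
  then obtain O' where O': "openin (product_topology ?X ?I) O'"
    "{x \<in> carrier (profinite_completion G). \<phi> x \<in> {\<phi> p}} = O' \<inter> carrier (profinite_completion G)"
    unfolding topspace_profinite_topology unfolding profinite_topology_def openin_subtopology by blast
  then have "p \<in> O'" using p by blast
  then obtain U where U: "finite {R \<in> ?I. U R \<noteq> topspace (?X R)}" "p \<in> Pi\<^sub>E ?I U" "Pi\<^sub>E ?I U \<subseteq> O'"
    using O'(1) unfolding openin_product_topology_alt by meson
  obtain w where w: "w \<in> carrier G" "\<And>R. R \<in> {R \<in> ?I. U R \<noteq> topspace (?X R)} \<Longrightarrow> p R = R `` {w}"
    using profinite_completion_approx[OF G p U(1)] by blast
  have "to_completion G w R \<in> U R" if "R \<in> ?I" for R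
  proof (cases "U R = topspace (?X R)")
    case True
    then show ?thesis using that w(1) by (auto simp: to_completion_def intro: quotientI)
  next
    case False
    then have "to_completion G w R = p R" using that w(2) by (simp add: to_completion_def)
    then show ?thesis using U(2) that by auto
  qed
  then have "to_completion G w \<in> Pi\<^sub>E ?I U" by (auto simp: to_completion_def)
  then have "\<phi> (to_completion G w) = \<phi> p" using O'(2) U(3) to_completion_carrier[OF w(1)] by blast
  then show ?thesis using w(1) by metis
qed

section \<open>Pseudoidentities and generated subsemigroups\<close>

lemma is_semigroup_free_semigroup: "is_semigroup (free_semigroup r)"
  by (auto simp: is_semigroup_def free_semigroup_def)

lemma sg_generated_subset:
  assumes "is_semigroup S" "A \<subseteq> carrier S"
  shows "sg_generated S A \<subseteq> carrier S"
proof
  show "x \<in> carrier S" if "x \<in> sg_generated S A" for x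
    using that by induction (use assms in \<open>auto simp: is_semigroup_def\<close>)
qed

text \<open>By density \<open>\<phi> p\<close> is also the image of a word, hence a product of
  images of letters.\<close>

lemma hom_image_free_profinite:
  assumes hom: "is_sg_hom \<phi> (free_profinite r) S"
    and cont: "continuous_map (free_profinite_topology r) (discrete_topology (carrier S)) \<phi>"
    and p: "p \<in> carrier (free_profinite r)"
  shows "\<phi> p \<in> sg_generated S ((\<lambda>i. \<phi> (to_completion (free_semigroup r) [i])) ` {1..r})"
proof -
  let ?F = "free_semigroup r"
  let ?A = "(\<lambda>i. \<phi> (to_completion ?F [i])) ` {1..r}"
  have gen: "\<phi> (to_completion ?F w) \<in> sg_generated S ?A" if "w \<in> carrier ?F" for w
  proof -
    have "w \<noteq> []" "set w \<subseteq> {1..r}" using that by (auto simp: free_semigroup_def)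
    then show ?thesis
    proof (induction w rule: list_nonempty_induct)
      case (single x)
      then show ?case by (auto intro: sg_generated.incl)
    next
      case (cons x xs)
      have c: "[x] \<in> carrier ?F" "xs \<in> carrier ?F" using cons by (auto simp: free_semigroup_def)
      have "x # xs = [x] \<cdot>\<^bsub>?F\<^esub> xs" by (simp add: free_semigroup_def)
      then have "to_completion ?F (x # xs) =
        to_completion ?F [x] \<cdot>\<^bsub>free_profinite r\<^esub> to_completion ?F xs"
        using to_completion_mult[OF is_semigroup_free_semigroup c] by (simp add: free_profinite_def)
      then have "\<phi> (to_completion ?F (x # xs)) = \<phi> (to_completion ?F [x]) \<cdot>\<^bsub>S\<^esub> \<phi> (to_completion ?F xs)"
        using hom to_completion_carrier[OF c(1)] to_completion_carrier[OF c(2)]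
        unfolding is_sg_hom_def free_profinite_def by simp
      moreover have "\<phi> (to_completion ?F [x]) \<in> sg_generated S ?A"
        using cons.prems by (auto intro: sg_generated.incl)
      ultimately show ?case using cons by (auto intro: sg_generated.mult)
    qed
  qed
  show ?thesis
    using continuous_map_completion_dense[OF is_semigroup_free_semigroup, of p r] cont p gen
    unfolding free_profinite_topology_def free_profinite_def by metis
qed

text \<open>A continuous homomorphism into \<open>S\<close> takes its values in the subsemigroup
  generated by the images of the variables, so it can be corestricted to a subsemigroup covered by
  the assumption.\<close>

lemma satisfies_of_generated_subsemigroups:
  assumes S: "is_semigroup S" and e: "is_pseudoidentity e"
    and sub: "\<And>T. is_subsemigroup T S \<Longrightarrow> n_generated (fst e) (S\<lparr>carrier := T\<rparr>) \<Longrightarrow>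
      satisfies (S\<lparr>carrier := T\<rparr>) e"
  shows "satisfies S e"
proof -
  obtain r p q where rpq: "e = (r, p, q)" by (cases e)
  have "\<phi> p = \<phi> q"
    if hom: "is_sg_hom \<phi> (free_profinite r) S"
      and cont: "continuous_map (free_profinite_topology r) (discrete_topology (carrier S)) \<phi>" for \<phi>
  proof -
    define A where "A = (\<lambda>i. \<phi> (to_completion (free_semigroup r) [i])) ` {1..r}"
    define T where "T = sg_generated S A"
    have "to_completion (free_semigroup r) [i] \<in> carrier (free_profinite r)" if "i \<in> {1..r}" for i
      unfolding free_profinite_def
      by (rule to_completion_carrier) (use that in \<open>auto simp: free_semigroup_def\<close>)
    then have A: "A \<subseteq> carrier S" using hom unfolding A_def is_sg_hom_def by blast
    have TS: "T \<subseteq> carrier S" unfolding T_def by (rule sg_generated_subset[OF S A])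
    then have T: "is_subsemigroup T S"
      unfolding is_subsemigroup_def T_def by (auto intro: sg_generated.mult)
    have "card A \<le> r" unfolding A_def using card_image_le[of "{1..r}"] by fastforce
    then have "n_generated r (S\<lparr>carrier := T\<rparr>)"
      unfolding n_generated_def
      by (intro exI[of _ A]) (auto simp: T_def A_def intro: sg_generated.incl)
    with T have sat: "satisfies (S\<lparr>carrier := T\<rparr>) e" using sub rpq by simp
    have img: "\<phi> x \<in> T" if "x \<in> carrier (free_profinite r)" for x
      using hom_image_free_profinite[OF hom cont that] unfolding T_def A_def .
    have "is_sg_hom \<phi> (free_profinite r) (S\<lparr>carrier := T\<rparr>)"
      using hom img unfolding is_sg_hom_def by simp
    moreover have "continuous_map (free_profinite_topology r) (discrete_topology T) \<phi>"
      using cont img TS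
      unfolding continuous_map_def free_profinite_topology_def free_profinite_def topspace_profinite_topology
      by auto
    ultimately show ?thesis using sat unfolding rpq satisfies_def by simp
  qed
  then show ?thesis unfolding rpq satisfies_def by simp
qed

lemma n_generated_mono: "n_generated m S \<Longrightarrow> m \<le> n \<Longrightarrow> n_generated n S"
  unfolding n_generated_def by (meson le_trans)

lemma finitely_based_imp_finite_rank:
  assumes "finitely_based V"
  shows "\<not> infinite_rank V"
proof -
  obtain \<Sigma> where fin: "finite \<Sigma>" and basis: "is_basis \<Sigma> V"
    using assms unfolding finitely_based_def by blast
  \<comment> \<open>The largest number of variables in the basis; the inserted 0 covers the empty
    basis.\<close>
  define k where "k = Max (insert 0 (fst ` \<Sigma>))"
  have k: "fst e \<le> k" if "e \<in> \<Sigma>" for e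
    using fin that unfolding k_def by (intro Max_ge) auto
  have V: "V = {S. finite_semigroup S \<and> (\<forall>e\<in>\<Sigma>. satisfies S e)}" and ps: "\<And>e. e \<in> \<Sigma> \<Longrightarrow> is_pseudoidentity e"
    using basis unfolding is_basis_def by blast+
  have "rank_at_most k V"
    unfolding rank_at_most_def
  proof (intro allI impI, elim conjE)
    fix S :: "'a semigrp"
    assume S: "finite_semigroup S"
      and sub: "\<forall>T. is_subsemigroup T S \<and> n_generated k (S\<lparr>carrier := T\<rparr>) \<longrightarrow> S\<lparr>carrier := T\<rparr> \<in> V"
    have "satisfies S e" if e: "e \<in> \<Sigma>" for e
    proof (rule satisfies_of_generated_subsemigroups[OF _ ps[OF e]])
      show "is_semigroup S" using S unfolding finite_semigroup_def by simp
      fix T assume "is_subsemigroup T S" "n_generated (fst e) (S\<lparr>carrier := T\<rparr>)"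
      then have "S\<lparr>carrier := T\<rparr> \<in> V" using sub n_generated_mono[OF _ k[OF e]] by blast
      then show "satisfies (S\<lparr>carrier := T\<rparr>) e" using V e by blast
    qed
    then show "S \<in> V" using S V by blast
  qed
  then show ?thesis unfolding infinite_rank_def by blast
qed

section \<open>A labelled graph\<close>

text \<open>
  \<open>nt_word False k\<close> is \<open>\<lambda>\<^sub>k\<^sub>+\<^sub>1\<close> and \<open>nt_word True k\<close> is \<open>\<rho>\<^sub>k\<^sub>+\<^sub>1\<close>, for \<open>x = 0\<close>, \<open>y = 1\<close>,
  \<open>z\<^sub>1 = 1\<close> and the letter \<open>i\<close> as the parameter \<open>z\<^sub>i\<close>, \<open>i \<ge> 2\<close>.
\<close>

fun nt_word :: "bool \<Rightarrow> nat \<Rightarrow> nat list" where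
  "nt_word s 0 = [of_bool s, of_bool (\<not> s)]"
| "nt_word s (Suc k) = nt_word s k @ (k + 2) # nt_word (\<not> s) k"

section \<open>Combinatorics of the path labels\<close>

definition ell :: "nat \<Rightarrow> nat" where
  "ell k = length (nt_word False k)"

lemma length_nt_word [simp]: "length (nt_word s k) = ell k"
proof -
  have "length (nt_word s k) = length (nt_word s' k)" for s'
  proof (induction k arbitrary: s s')
    case (Suc k)
    show ?case using Suc[of s s'] Suc[of "\<not> s" "\<not> s'"] by simp
  qed simp
  then show ?thesis by (simp add: ell_def)
qed

lemma ell_Suc [simp]: "ell (Suc k) = 2 * ell k + 1"
  unfolding ell_def[of "Suc k"] by simp

lemma ell_ge_2: "2 \<le> ell k"
proof (induction k)
  case 0
  show ?case unfolding ell_def by simp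
qed simp

lemma nt_word_nonempty [simp]: "nt_word s k \<noteq> []"
  by (cases k) auto

lemma nth_0_nt_word: "nt_word s k ! 0 = of_bool s"
proof (induction k arbitrary: s)
  case (Suc k)
  then show ?case using ell_ge_2[of k] by (auto simp: nth_append)
qed simp

text \<open>Passing to the next level only exchanges the two last letters.\<close>

lemma last_nt_word_neq: "last (nt_word s k) \<noteq> last (nt_word (\<not> s) k)"
proof (induction k arbitrary: s)
  case (Suc k)
  from Suc[of s] show ?case by auto
qed simp

lemma set_nt_word: "set (nt_word s k) = {..<k + 2}"
proof (induction k arbitrary: s)
  case 0
  show ?case by (cases s) auto
next
  case (Suc k)
  then show ?case by auto
qed

lemma nth_nt_word_less: "t < ell k \<Longrightarrow> nt_word s k ! t < k + 2"
  using nth_mem[of t "nt_word s k"] by (simp add: set_nt_word)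

text \<open>The letter \<open>k + 2\<close> is new at level \<open>k + 1\<close>; the halves around
  it use smaller letters only.\<close>

lemma nth_nt_word_Suc_eq_middle_iff:
  assumes "t < ell (Suc k)"
  shows "nt_word s (Suc k) ! t = k + 2 \<longleftrightarrow> t = ell k"
proof -
  consider "t < ell k" | "t = ell k" | t' where "t = Suc (ell k + t')" "t' < ell k"
  proof -
    have "t < ell k \<or> t = ell k \<or> t = Suc (ell k + (t - Suc (ell k))) \<and> t - Suc (ell k) < ell k"
      using assms by auto
    then show ?thesis using that by blast
  qed
  then show ?thesis
  proof cases
    case 1
    then show ?thesis using nth_nt_word_less[of t k s] by (simp add: nth_append)
  next
    case 2
    then show ?thesis by (simp add: nth_append)
  next
    case 3
    then show ?thesis using nth_nt_word_less[of t' k "\<not> s"] by (simp add: nth_append)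
  qed
qed

text \<open>The only occurrence of \<open>k + 2\<close> marks the middle of both words. It cannot
  lie in \<open>U\<close> or \<open>V\<close>, since exchanging these would move it off the middle.
  So it lies in \<open>X\<close>, and the distinct last letters of the two first halves leave no
  room in \<open>X\<close> for anything else.\<close>

lemma nt_word_descent:
  assumes eq1: "U @ X @ V = nt_word s (Suc k)" and eq2: "V @ X @ U = nt_word (\<not> s) (Suc k)"
    and ne: "U \<noteq> []" "V \<noteq> []"
  shows "X = [k + 2] \<and> U = nt_word s k \<and> V = nt_word (\<not> s) k"
proof -
  have len: "length U + length X + length V = 2 * ell k + 1"
    using arg_cong[OF eq1, of length] by simp
  have pos1: "(U @ X @ V) ! t = k + 2 \<longleftrightarrow> t = ell k" if "t < 2 * ell k + 1" for t
    using nth_nt_word_Suc_eq_middle_iff[of t k s] that unfolding eq1 by simp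
  have pos2: "(V @ X @ U) ! t = k + 2 \<longleftrightarrow> t = ell k" if "t < 2 * ell k + 1" for t
    using nth_nt_word_Suc_eq_middle_iff[of t k "\<not> s"] that unfolding eq2 by simp
  have U: "length U \<le> ell k"
  proof (rule ccontr)
    assume "\<not> ?thesis"
    then have "U ! ell k = k + 2" using pos1[of "ell k"] by (simp add: nth_append)
    then have "(V @ X @ U) ! (length V + length X + ell k) = k + 2"
      by (simp add: nth_append)
    with pos2[of "length V + length X + ell k"] \<open>\<not> ?thesis\<close> ne(2) len show False by simp
  qed
  have V: "length V \<le> ell k"
  proof (rule ccontr)
    assume "\<not> ?thesis"
    then have "V ! ell k = k + 2" using pos2[of "ell k"] by (simp add: nth_append)
    then have "(U @ X @ V) ! (length U + length X + ell k) = k + 2"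
      by (simp add: nth_append)
    with pos1[of "length U + length X + ell k"] \<open>\<not> ?thesis\<close> ne(1) len show False by simp
  qed
  \<comment> \<open>The marker has the same offset in \<open>X\<close> in both words, and it is in
    the middle of both; hence \<open>U\<close> and \<open>V\<close> are equally long.\<close>
  have "X ! (ell k - length U) = k + 2"
    using pos1[of "ell k"] U V len by (simp add: nth_append split: if_splits)
  moreover have "(V @ X @ U) ! (length V + i) = X ! i" if "i < length X" for i
    using that by (simp add: nth_append)
  moreover have "ell k - length U < length X" using U V len by linarith
  ultimately have "(V @ X @ U) ! (length V + (ell k - length U)) = k + 2"
    by metis
  moreover have "length V + (ell k - length U) < 2 * ell k + 1" using U V by linarith
  ultimately have "length V + (ell k - length U) = ell k"
    using pos2 by blast
  then have UV: "length U = length V" using U by linarith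
  \<comment> \<open>If \<open>U\<close> were shorter, the letter just before the middle would belong
    to \<open>X\<close> and be the same in both words, against
    \<open>last_nt_word_neq\<close>.\<close>
  have "length U = ell k"
  proof (rule ccontr)
    assume "\<not> ?thesis"
    then have lt: "length U < ell k" using U by simp
    define i where "i = ell k - 1 - length U"
    have i: "ell k - 1 = length U + i" "ell k - 1 = length V + i" "i < length X"
      using lt len UV unfolding i_def by linarith+
    have last: "last (nt_word s' k) = nt_word s' (Suc k) ! (ell k - 1)" for s'
      using lt by (simp add: last_conv_nth nth_append)
    have "last (nt_word s k) = X ! i"
      using i(3) unfolding last eq1[symmetric] i(1) by (simp add: nth_append)
    moreover have "last (nt_word (\<not> s) k) = X ! i"
      using i(3) unfolding last eq2[symmetric] i(2) by (simp add: nth_append)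
    ultimately show False using last_nt_word_neq by metis
  qed
  then have "U = nt_word s k \<and> X @ V = (k + 2) # nt_word (\<not> s) k"
    using eq1 append_eq_append_conv[of U "nt_word s k" "X @ V"] by simp
  moreover have "length X = 1" using len UV \<open>length U = ell k\<close> by linarith
  ultimately show ?thesis by (cases X) auto
qed

text \<open>The vertices \<open>(s, t)\<close> with \<open>t \<le> ell (d + 1)\<close> form the path labelled by \<open>nt_word s (d + 1)\<close>.\<close>

definition edge :: "nat \<Rightarrow> nat \<Rightarrow> (bool \<times> nat) rel" where
  "edge d x =
     {((s, t), (s, Suc t)) | s t. t < ell (Suc d) \<and> nt_word s (Suc d) ! t = x} \<union>
     {((s, ell (Suc d)), (\<not> s, 0)) | s. x = d + 3} \<union>
     {((s, ell (Suc d)), (s, 0)) | s. x = d + 4}"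

text \<open>The empty word acts as the identity on all pairs, even on those that are not vertices,
  so only nonempty words are sure to act within the graph.\<close>

primrec run :: "nat \<Rightarrow> nat list \<Rightarrow> (bool \<times> nat) rel" where
  "run d [] = Id"
| "run d (x # w) = edge d x O run d w"

lemma run_append: "run d (u @ v) = run d u O run d v"
  by (induction u) auto

lemma edge_cases:
  assumes "(p, q) \<in> edge d x"
  obtains (path) s t where "p = (s, t)" "q = (s, Suc t)" "t < ell (Suc d)" "x = nt_word s (Suc d) ! t" "x < d + 3"
  | (flip) s where "p = (s, ell (Suc d))" "q = (\<not> s, 0)" "x = d + 3"
  | (stay) s where "p = (s, ell (Suc d))" "q = (s, 0)" "x = d + 4"
  using assms unfolding edge_def
proof (elim UnE)
  assume "(p, q) \<in> {((s, t), (s, Suc t)) | s t. t < ell (Suc d) \<and> nt_word s (Suc d) ! t = x}"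
  then obtain s t where st: "p = (s, t)" "q = (s, Suc t)" "t < ell (Suc d)" "x = nt_word s (Suc d) ! t"
    by blast
  then show ?thesis using path nth_nt_word_less[OF st(3), of s] by simp
qed (use flip stay in blast)+

text \<open>Before the end of a path there is one outgoing edge; the two edges that leave an end
  carry different letters.\<close>

lemma edge_right_unique: "(p, q) \<in> edge d x \<Longrightarrow> (p, q') \<in> edge d x \<Longrightarrow> q = q'"
  by (auto elim!: edge_cases simp del: ell_Suc nt_word.simps)

text \<open>Dually, only the starts have two incoming edges, with different letters. So every word
  acts as a partial injection.\<close>

lemma edge_left_unique: "(p, q) \<in> edge d x \<Longrightarrow> (p', q) \<in> edge d x \<Longrightarrow> p = p'"
  by (auto elim!: edge_cases simp del: ell_Suc nt_word.simps)

lemma run_right_unique: "(p, q) \<in> run d w \<Longrightarrow> (p, q') \<in> run d w \<Longrightarrow> q = q'"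
  by (induction w arbitrary: p) (auto dest: edge_right_unique)

lemma run_left_unique: "(p, q) \<in> run d w \<Longrightarrow> (p', q) \<in> run d w \<Longrightarrow> p = p'"
proof (induction w arbitrary: p p')
  case (Cons x w)
  then obtain r r' where "(p, r) \<in> edge d x" "(r, q) \<in> run d w" "(p', r') \<in> edge d x" "(r', q) \<in> run d w"
    by auto
  then show ?case using Cons.IH edge_left_unique by blast
qed simp

text \<open>Among the path edges only the middle ones carry a letter as large as
  \<open>d + 2\<close>.\<close>

lemma big_edge_cases:
  assumes "(p, q) \<in> edge d x" "d + 2 \<le> x"
  obtains (middle) s where "p = (s, ell d)" "q = (s, Suc (ell d))" "x = d + 2"
  | (flip) s where "p = (s, ell (Suc d))" "q = (\<not> s, 0)" "x = d + 3"
  | (stay) s where "p = (s, ell (Suc d))" "q = (s, 0)" "x = d + 4"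
  using assms(1)
proof (cases rule: edge_cases)
  case (path s t)
  then have "nt_word s (Suc d) ! t = d + 2" using assms(2) by simp
  then have "t = ell d" using nth_nt_word_Suc_eq_middle_iff[of t d s] path by simp
  then show ?thesis using middle path assms(2) by simp
qed (use that in auto)

lemma small_edgeD:
  assumes "((s, t), q) \<in> edge d x" "x < d + 2"
  shows "q = (s, Suc t)" "t < ell (Suc d)" "t \<noteq> ell d" "nt_word s (Suc d) ! t = x"
proof -
  have "q = (s, Suc t) \<and> t < ell (Suc d) \<and> nt_word s (Suc d) ! t = x"
    using assms(1)
  proof (cases rule: edge_cases)
    case (path s' t')
    then show ?thesis by simp
  qed (use assms(2) in auto)
  moreover from this have "t \<noteq> ell d"
    using nth_nt_word_Suc_eq_middle_iff[of t d s] assms(2) by auto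
  ultimately show "q = (s, Suc t)" "t < ell (Suc d)" "t \<noteq> ell d" "nt_word s (Suc d) ! t = x"
    by blast+
qed

text \<open>Each of these letters labels at most two edges, which are exchanged by negating the
  Boolean components.\<close>

lemma big_edges_complementary:
  assumes "(p, q) \<in> edge d x" "(p', q') \<in> edge d x" "p \<noteq> p'" "d + 2 \<le> x"
  shows "p' = (\<not> fst p, snd p)" "q' = (\<not> fst q, snd q)"
proof -
  have "p' = (\<not> fst p, snd p) \<and> q' = (\<not> fst q, snd q)"
    using assms(1,4)
  proof (cases rule: big_edge_cases)
    case (middle s)
    from assms(2,4) show ?thesis by (cases rule: big_edge_cases) (use middle assms(3) in auto)
  next
    case (flip s)
    from assms(2,4) show ?thesis by (cases rule: big_edge_cases) (use flip assms(3) in auto)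
  next
    case (stay s)
    from assms(2,4) show ?thesis by (cases rule: big_edge_cases) (use stay assms(3) in auto)
  qed
  then show "p' = (\<not> fst p, snd p)" "q' = (\<not> fst q, snd q)" by blast+
qed

text \<open>The letter \<open>d + 2\<close> in the middle of each path and the two letters outside the paths separate
  the two paths: their sources have no common incoming letter, their targets no common outgoing one.\<close>

lemma big_edges_no_common_next:
  assumes "(p, q) \<in> edge d x" "(p', q') \<in> edge d x" "p \<noteq> p'" "d + 2 \<le> x"
    and "(q, r) \<in> edge d y" "(q', r') \<in> edge d y"
  shows False
proof -
  have start: "y = of_bool s" if "((s, 0), r) \<in> edge d y" for s r
    using that
  proof (cases rule: edge_cases)
    case (path s t)
    then show ?thesis using nth_0_nt_word[of s "Suc d"] by (simp del: nt_word.simps)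
  qed (use ell_ge_2[of "Suc d"] in auto)
  \<comment> \<open>Behind the middle edge of path \<open>s\<close> begins its second half, labelled
    \<open>nt_word (\<not> s) d\<close>.\<close>
  have mid: "y = of_bool (\<not> s)" if "((s, Suc (ell d)), r) \<in> edge d y" for s r
    using that
  proof (cases rule: edge_cases)
    case (path s t)
    then show ?thesis using nth_0_nt_word[of "\<not> s" d] by (simp add: nth_append)
  qed (use ell_ge_2[of d] in auto)
  have q': "q' = (\<not> fst q, snd q)"
    using big_edges_complementary[OF assms(1-4)] by simp
  have "\<exists>s. q = (s, Suc (ell d)) \<or> q = (s, 0)"
    using assms(1,4) by (cases rule: big_edge_cases) auto
  then obtain s where "q = (s, Suc (ell d)) \<or> q = (s, 0)" ..
  then have "y = of_bool s \<and> y = of_bool (\<not> s)"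
  proof
    assume "q = (s, Suc (ell d))"
    then show ?thesis using mid[of s r] mid[of "\<not> s" r'] assms(5,6) q' by simp
  next
    assume "q = (s, 0)"
    then show ?thesis using start[of s r] start[of "\<not> s" r'] assms(5,6) q' by simp
  qed
  then show False by (cases s) auto
qed

text \<open>The sources are ends of paths or of first halves. The letters leading there are last
  letters of opposite words, which differ by \<open>last_nt_word_neq\<close>.\<close>

lemma big_edges_no_common_previous:
  assumes "(p, q) \<in> edge d x" "(p', q') \<in> edge d x" "p \<noteq> p'" "d + 2 \<le> x"
    and "(r, p) \<in> edge d y" "(r', p') \<in> edge d y"
  shows False
proof -
  have fin: "y = last (nt_word s (Suc d))" if "(r, (s, ell (Suc d))) \<in> edge d y" for s r
    using that
  proof (cases rule: edge_cases)
    case (path s' t)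
    then have "t = ell (Suc d) - 1" by simp
    with path show ?thesis by (simp add: last_conv_nth del: nt_word.simps ell_Suc)
  qed auto
  have mid: "y = last (nt_word s d)" if "(r, (s, ell d)) \<in> edge d y" for s r
    using that
  proof (cases rule: edge_cases)
    case (path s' t)
    then have "t = ell d - 1" "t < ell d" by simp_all
    with path show ?thesis by (simp add: last_conv_nth nth_append)
  qed (use ell_ge_2[of d] in auto)
  have p': "p' = (\<not> fst p, snd p)"
    using big_edges_complementary[OF assms(1-4)] by simp
  have "\<exists>s. p = (s, ell d) \<or> p = (s, ell (Suc d))"
    using assms(1,4) by (cases rule: big_edge_cases) auto
  then obtain s where "p = (s, ell d) \<or> p = (s, ell (Suc d))" ..
  then show False
  proof
    assume "p = (s, ell d)"
    then show ?thesis
      using mid[of r s] mid[of r' "\<not> s"] assms(5,6) p' last_nt_word_neq[of s d] by simp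
  next
    assume "p = (s, ell (Suc d))"
    then show ?thesis
      using fin[of r s] fin[of r' "\<not> s"] assms(5,6) p' last_nt_word_neq[of s "Suc d"]
      by (simp del: nt_word.simps ell_Suc)
  qed
qed

section \<open>Words that can be read from two vertices\<close>

lemma two_runs_big_letter:
  assumes "(p, q) \<in> run d w" "(p', q') \<in> run d w" "p \<noteq> p'" "x \<in> set w" "d + 2 \<le> x"
  shows "w = [x]"
proof -
  obtain u v where w: "w = u @ x # v" using assms(4) by (meson split_list)
  obtain p1 q1 where 1: "(p, p1) \<in> run d u" "(p1, q1) \<in> edge d x" "(q1, q) \<in> run d v"
    using assms(1) unfolding w run_append by auto
  obtain p2 q2 where 2: "(p', p2) \<in> run d u" "(p2, q2) \<in> edge d x" "(q2, q') \<in> run d v"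
    using assms(2) unfolding w run_append by auto
  \<comment> \<open>Injectivity keeps the two runs apart up to the letter \<open>x\<close>, so
    nothing can precede or follow it.\<close>
  have neq: "p1 \<noteq> p2" using 1 2 assms(3) run_left_unique by blast
  have "v = []"
    using 1(3) 2(3) big_edges_no_common_next[OF 1(2) 2(2) neq assms(5)] by (cases v) auto
  moreover have "u = []"
    using 1(1) 2(1) big_edges_no_common_previous[OF 1(2) 2(2) neq assms(5)]
    by (cases u rule: rev_cases) (auto simp: run_append)
  ultimately show ?thesis using w by simp
qed

text \<open>Letters below \<open>d + 2\<close> label path edges other than the middle ones. Such a
  word therefore stays on its path, does not cross the middle, and is a factor of the path
  label.\<close>

lemma small_run:
  assumes "((s, t), q) \<in> run d w" "\<forall>x\<in>set w. x < d + 2"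
  shows "q = (s, t + length w)"
    and "t \<le> ell d \<Longrightarrow> t + length w \<le> ell d"
    and "w \<noteq> [] \<Longrightarrow> t + length w \<le> ell (Suc d)"
    and "w = take (length w) (drop t (nt_word s (Suc d)))"
proof -
  have "q = (s, t + length w) \<and> (t \<le> ell d \<longrightarrow> t + length w \<le> ell d) \<and>
    (w \<noteq> [] \<longrightarrow> t + length w \<le> ell (Suc d)) \<and>
    w = take (length w) (drop t (nt_word s (Suc d)))"
    using assms
  proof (induction w arbitrary: t)
    case (Cons x w)
    then obtain p where p: "((s, t), p) \<in> edge d x" "(p, q) \<in> run d w" by auto
    note e = small_edgeD[OF p(1)]
    have "x < d + 2" using Cons.prems by simp
    note e = e[OF this]
    have "q = (s, Suc t + length w) \<and> (Suc t \<le> ell d \<longrightarrow> Suc t + length w \<le> ell d) \<and>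
      (w \<noteq> [] \<longrightarrow> Suc t + length w \<le> ell (Suc d)) \<and>
      w = take (length w) (drop (Suc t) (nt_word s (Suc d)))"
      using Cons.IH[of "Suc t"] p(2) e(1) Cons.prems(2) by simp
    moreover have "drop t (nt_word s (Suc d)) = x # drop (Suc t) (nt_word s (Suc d))"
      using e Cons_nth_drop_Suc[of t "nt_word s (Suc d)"] by (simp del: nt_word.simps ell_Suc)
    ultimately show ?case using e(2,3) by (auto simp del: nt_word.simps)
  qed auto
  then show "q = (s, t + length w)"
    and "t \<le> ell d \<Longrightarrow> t + length w \<le> ell d"
    and "w \<noteq> [] \<Longrightarrow> t + length w \<le> ell (Suc d)"
    and "w = take (length w) (drop t (nt_word s (Suc d)))"
    by blast+
qed

lemma two_runs_cases:
  assumes "(p, q) \<in> run d w" "(p', q') \<in> run d w" "p \<noteq> p'"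
  obtains (small) "\<forall>x\<in>set w. x < d + 2" | (big) x where "w = [x]" "d + 2 \<le> x"
  using two_runs_big_letter[OF assms] by (meson leI)

text \<open>The middle edge cuts a path into two halves of \<open>ell d\<close> edges each.\<close>

lemma small_run_length:
  assumes "(p, q) \<in> run d w" "\<forall>x\<in>set w. x < d + 2"
  shows "length w \<le> ell d"
proof (cases "snd p \<le> ell d \<or> w = []")
  case True
  then show ?thesis using small_run(2)[of "fst p" "snd p" q d w] assms by auto
next
  case False
  then show ?thesis using small_run(3)[of "fst p" "snd p" q d w] assms by auto
qed

text \<open>A word readable from two vertices is a single letter or lies within half a path, so it
  has length at most \<open>ell d\<close>.\<close>

lemma long_run_unique:
  assumes "(p, q) \<in> run d w" "(p', q') \<in> run d w" "ell d < length w"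
  shows "p' = p \<and> q' = q"
proof -
  have "p = p'"
  proof (rule ccontr)
    assume "p \<noteq> p'"
    with assms(1,2) show False
    proof (cases rule: two_runs_cases)
      case small
      then show ?thesis using small_run_length assms by fastforce
    next
      case (big x)
      then show ?thesis using assms(3) ell_ge_2[of d] by simp
    qed
  qed
  then show ?thesis using assms run_right_unique by blast
qed

section \<open>Connections between the starts and the ends of the paths\<close>

lemma run_take_drop:
  "t + l \<le> ell (Suc d) \<Longrightarrow> ((s, t), (s, t + l)) \<in> run d (take l (drop t (nt_word s (Suc d))))"
proof (induction l arbitrary: t)
  case (Suc l)
  have "drop t (nt_word s (Suc d)) = nt_word s (Suc d) ! t # drop (Suc t) (nt_word s (Suc d))"
    using Suc.prems Cons_nth_drop_Suc[of t "nt_word s (Suc d)"] by (simp del: nt_word.simps ell_Suc)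
  moreover have "((s, t), (s, Suc t)) \<in> edge d (nt_word s (Suc d) ! t)"
    using Suc.prems unfolding edge_def by auto
  ultimately show ?case using Suc.IH[of "Suc t"] Suc.prems by (auto simp del: nt_word.simps ell_Suc)
qed simp

lemma run_nt_word: "((s, 0), (s, ell (Suc d))) \<in> run d (nt_word s (Suc d))"
  using run_take_drop[of 0 "ell (Suc d)" d s] by (simp del: nt_word.simps ell_Suc)

text \<open>Both \<open>X\<close> and \<open>Y\<close> can be read from \<open>\<alpha>\<close> and
  from \<open>\<beta>\<close>. If one of them is a letter outside the paths, the claim is immediate.
  Otherwise both keep the Boolean component, and comparing components and positions yields
  \<open>\<alpha> = \<beta>\<close>, a contradiction.\<close>

lemma loop_states:
  assumes X: "(\<alpha>, j) \<in> run d X" "(\<beta>, i) \<in> run d X"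
    and Y: "(\<beta>, j) \<in> run d Y" "(\<alpha>, i) \<in> run d Y"
    and neq: "(i, \<alpha>) \<noteq> (j, \<beta>)"
  shows "\<exists>s s'. i = (s, 0) \<and> j = (\<not> s, 0) \<and> \<alpha> = (s', ell (Suc d)) \<and> \<beta> = (\<not> s', ell (Suc d))"
proof -
  \<comment> \<open>Since \<open>X\<close> acts as a partial injection, \<open>i = j\<close> and
    \<open>\<alpha> = \<beta>\<close> would imply each other.\<close>
  have ij: "i \<noteq> j" and ab: "\<alpha> \<noteq> \<beta>"
    using X neq run_left_unique run_right_unique by blast+
  have X_outer: ?thesis if "X = [x]" "x \<noteq> d + 2" "d + 2 \<le> x" for x
  proof -
    have E: "(\<alpha>, j) \<in> edge d x" "(\<beta>, i) \<in> edge d x" using X that(1) by auto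
    from E(1) that(3) show ?thesis
      using big_edges_complementary[OF E ab that(3)] that(2)
      by (cases rule: big_edge_cases) auto
  qed
  have Y_outer: ?thesis if "Y = [y]" "y \<noteq> d + 2" "d + 2 \<le> y" for y
  proof -
    have E: "(\<alpha>, i) \<in> edge d y" "(\<beta>, j) \<in> edge d y" using Y that(1) by auto
    from E(1) that(3) show ?thesis
      using big_edges_complementary[OF E ab that(3)] that(2)
      by (cases rule: big_edge_cases) auto
  qed
  have small: "fst q = fst p \<and> snd q = snd p + length w"
    if "(p, q) \<in> run d w" "\<forall>x\<in>set w. x < d + 2" for p q w
    using small_run(1)[of "fst p" "snd p" q d w] that by auto
  have middle: "snd p = ell d \<and> fst q = fst p" if "(p, q) \<in> run d [d + 2]" for p q
  proof -
    have "(p, q) \<in> edge d (d + 2)" using that by simp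
    then show ?thesis by (cases rule: big_edge_cases) auto
  qed
  have contr: False if "fst \<alpha> = fst \<beta>" "snd \<alpha> = snd \<beta>"
    using that ab by (simp add: prod_eq_iff)
  from X ab show ?thesis
  proof (cases rule: two_runs_cases)
    case Xs: small
    note X' = small[OF X(1) Xs] small[OF X(2) Xs]
    from Y ab[symmetric] show ?thesis
    proof (cases rule: two_runs_cases)
      case Ys: small
      note Y' = small[OF Y(1) Ys] small[OF Y(2) Ys]
      have "fst \<alpha> = fst \<beta>" using X' Y' by metis
      moreover have "snd \<alpha> = snd \<beta>" using X' Y' by linarith
      ultimately show ?thesis using contr by blast
    next
      case (big y)
      show ?thesis
      proof (cases "y = d + 2")
        case True
        then have Y': "snd \<alpha> = ell d" "snd \<beta> = ell d" "fst j = fst \<beta>"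
          using middle[of \<beta> j] middle[of \<alpha> i] Y big by blast+
        then show ?thesis using X' contr by metis
      qed (use Y_outer big in blast)
    qed
  next
    case Xb: (big x)
    show ?thesis
    proof (cases "x = d + 2")
      case True
      then have X': "snd \<alpha> = ell d" "fst j = fst \<alpha>" "snd \<beta> = ell d" "fst i = fst \<beta>"
        using middle[of \<alpha> j] middle[of \<beta> i] X Xb by blast+
      from Y ab[symmetric] show ?thesis
      proof (cases rule: two_runs_cases)
        case Ys: small
        show ?thesis using X' small[OF Y(1) Ys] contr by metis
      next
        case (big y)
        show ?thesis
        proof (cases "y = d + 2")
          case True
          then have "fst j = fst \<beta>" using middle[of \<beta> j] Y big by blast
          then show ?thesis using X' contr by metis
        qed (use Y_outer big in blast)
      qed
    qed (use X_outer Xb in blast)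
  qed
qed

text \<open>One step back in time. The word \<open>U\<close> is read from a start and again from
  \<open>q'\<close>, and \<open>V\<close> from a start and again from \<open>q\<close>. If
  \<open>q'\<close> and \<open>q\<close> are these same starts, then \<open>U\<close> and
  \<open>V\<close> again lead from starts to ends. If neither is, both words are short and
  \<open>X\<close> must cross the middle. The mixed cases are impossible.\<close>

lemma top_descent:
  assumes 1: "((s, 0), (s', ell (Suc d))) \<in> run d (U @ X @ V)"
    and 2: "((\<not> s, 0), (\<not> s', ell (Suc d))) \<in> run d (V @ X @ U)"
    and ne: "U \<noteq> []" "V \<noteq> []"
  shows "X \<noteq> [] \<and>
    (((s, 0), (\<not> s', ell (Suc d))) \<in> run d U \<and> ((\<not> s, 0), (s', ell (Suc d))) \<in> run d V \<or>
     U = nt_word s d \<and> V = nt_word (\<not> s) d \<and> X = [d + 2])"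
proof -
  obtain p q where pq: "((s, 0), p) \<in> run d U" "(p, q) \<in> run d X" "(q, (s', ell (Suc d))) \<in> run d V"
    using 1 unfolding run_append by auto
  obtain p' q' where pq': "((\<not> s, 0), p') \<in> run d V" "(p', q') \<in> run d X" "(q', (\<not> s', ell (Suc d))) \<in> run d U"
    using 2 unfolding run_append by auto
  \<comment> \<open>A nonempty word readable from a start and from another vertex is a prefix of the
    first half of a path.\<close>
  have small: "(\<forall>x\<in>set w. x < d + 2) \<and> a = (b, length w) \<and> length w \<le> ell d \<and> w = take (length w) (nt_word b d)"
    if w: "((b, 0), a) \<in> run d w" "(a', c) \<in> run d w" "(b, 0) \<noteq> a'" "w \<noteq> []" for a a' b c w
    using w(1-3)
  proof (cases rule: two_runs_cases)
    case small
    have "length w \<le> ell d" using small_run(2)[OF w(1) small] by simp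
    then have "take (length w) (nt_word b (Suc d)) = take (length w) (nt_word b d)" by simp
    then show ?thesis
      using small small_run[OF w(1) small] by (auto simp del: nt_word.simps)
  next
    case (big x)
    then have False using w(1) ell_ge_2[of d] by (auto elim!: big_edge_cases)
    then show ?thesis ..
  qed
  \<comment> \<open>A word leading from inside a first half to a start has to pass the whole rest of
    the path, so it is readable from one vertex only.\<close>
  have long: "p1 = p2"
    if "(p1, (b', 0)) \<in> run d X" "(p2, q2) \<in> run d X" "p1 = (b, t)" "0 < t" "t \<le> ell d"
    for p1 p2 q2 b b' t
  proof (rule ccontr)
    assume "p1 \<noteq> p2"
    with that(1,2) show False
    proof (cases rule: two_runs_cases)
      case small
      then show ?thesis using small_run(1)[of b t "(b', 0)" d X] that by auto
    next
      case (big x)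
      then show ?thesis using that by (auto elim!: big_edge_cases)
    qed
  qed
  have lenU: "0 < length U" and lenV: "0 < length V" using ne by auto
  show ?thesis
  proof (cases "q' = (s, 0)")
    case True
    then have p: "p = (\<not> s', ell (Suc d))" using pq pq' run_right_unique by blast
    show ?thesis
    proof (cases "q = (\<not> s, 0)")
      case True
      then show ?thesis using p pq pq' run_right_unique by fastforce
    next
      case False
      note V = small[OF pq'(1) pq(3) False[symmetric] ne(2)]
      then have "p' = p" using long[of p' s p q "\<not> s" "length V"] pq(2) pq'(2) \<open>q' = (s, 0)\<close> lenV
        by auto
      then show ?thesis using p V by auto
    qed
  next
    case False
    note U = small[OF pq(1) pq'(3) False[symmetric] ne(1)]
    show ?thesis
    proof (cases "q = (\<not> s, 0)")
      case True
      then have p': "p' = (s', ell (Suc d))" using pq pq' run_right_unique by blast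
      have "p = p'" using long[of p "\<not> s" p' q' s "length U"] pq(2) pq'(2) True lenU U by auto
      then show ?thesis using p' U by auto
    next
      case False
      note V = small[OF pq'(1) pq(3) False[symmetric] ne(2)]
      have "snd q + length V = ell (Suc d)"
        using small_run(1)[of "fst q" "snd q" _ d V] pq(3) V by fastforce
      \<comment> \<open>As \<open>V\<close> is at most half a path long and finishes at an end,
        \<open>X\<close> arrives behind the middle, while it begins in a first half.\<close>
      then have q: "ell d < snd q" using V by simp
      have "p \<noteq> p'" using U V by auto
      with pq(2) pq'(2) show ?thesis
      proof (cases rule: two_runs_cases)
        case small
        have "snd q = length U + length X" "length U + length X \<le> ell d"
          using small_run(1,2)[of s "length U" q d X] small pq(2) U by auto
        then show ?thesis using q by simp
      next
        case (big x)
        then have x: "x = d + 2" "length U = ell d"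
          using pq(2) U by (auto elim!: big_edge_cases)
        moreover have "length V = ell d"
          using pq'(2) V big x by (auto elim!: big_edge_cases)
        ultimately show ?thesis using U V big by auto
      qed
    qed
  qed
qed

section \<open>Neumann--Taylor words along the graph\<close>

text \<open>The free monoid: the empty word is available for parameters equal to the
  identity.\<close>

definition word_sg :: "nat list semigrp" where
  "word_sg = \<lparr>carrier = UNIV, sgmult = (@)\<rparr>"

abbreviation lambda_word where "lambda_word \<equiv> nt_lambda word_sg"
abbreviation rho_word where "rho_word \<equiv> nt_rho word_sg"

lemma lambda_rho_word_Suc:
  "lambda_word A B X (Suc m) = lambda_word A B X m @ X (Suc m) @ rho_word A B X m"
  "rho_word A B X (Suc m) = rho_word A B X m @ X (Suc m) @ lambda_word A B X m"
  by (simp_all add: word_sg_def)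

declare nt_lambda.simps(2) [simp del] nt_rho.simps(2) [simp del]

lemma length_lambda_rho_word:
  assumes "A \<noteq> []" "B \<noteq> []"
  shows "m < length (lambda_word A B X m)" "m < length (rho_word A B X m)"
proof -
  have "m < length (lambda_word A B X m) \<and> m < length (rho_word A B X m)"
    using assms by (induction m) (auto simp: lambda_rho_word_Suc)
  then show "m < length (lambda_word A B X m)" "m < length (rho_word A B X m)" by auto
qed

text \<open>Repeated use of \<open>nt_word_descent\<close> recovers the letters as parameters, from
  the largest downwards. The empty parameter \<open>X 1\<close> ensures that none of them has index
  1.\<close>

lemma letters_of_nt_word:
  assumes "A \<noteq> []" "B \<noteq> []" "X 1 = []" "1 \<le> m"
    and "lambda_word A B X m = nt_word s k" "rho_word A B X m = nt_word (\<not> s) k" "l \<in> {2..<k + 2}"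
  shows "\<exists>i\<in>{2..m}. X i = [l]"
  using assms(4-)
proof (induction k arbitrary: m)
  case (Suc k)
  obtain m' where m: "m = Suc m'" using Suc.prems by (cases m) auto
  have ne: "lambda_word A B X m' \<noteq> []" "rho_word A B X m' \<noteq> []"
    using length_lambda_rho_word[OF assms(1,2), of m' X] by auto
  have desc: "X m = [k + 2]" "lambda_word A B X m' = nt_word s k" "rho_word A B X m' = nt_word (\<not> s) k"
    using nt_word_descent[OF _ _ ne, of "X m" s k] Suc.prems(2,3) unfolding m lambda_rho_word_Suc by auto
  have "m' \<noteq> 0"
  proof
    assume "m' = 0"
    then have "X 1 = [k + 2]" using desc(1) m by simp
    then show False using assms(3) by simp
  qed
  show ?case
  proof (cases "l = k + 2")
    case True
    then have "X m = [l]" "m \<in> {2..m}" using desc(1) m \<open>m' \<noteq> 0\<close> by simp_all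
    then show ?thesis by blast
  next
    case False
    then have "\<exists>i\<in>{2..m'}. X i = [l]"
      using Suc.IH[of m'] desc \<open>m' \<noteq> 0\<close> Suc.prems(4) by simp
    then show ?thesis using m by auto
  qed
qed simp

text \<open>Going back by \<open>top_descent\<close>, the words lead from starts to ends with
  \<open>s'\<close> negated each time, until they split into the two halves around
  \<open>d + 2\<close>; from there \<open>letters_of_nt_word\<close> takes over.\<close>

lemma letters_of_loop:
  assumes "A \<noteq> []" "B \<noteq> []" "X 1 = []" "1 \<le> m"
    and "((s, 0), (s', ell (Suc d))) \<in> run d (lambda_word A B X m)"
    and "((\<not> s, 0), (\<not> s', ell (Suc d))) \<in> run d (rho_word A B X m)"
    and "l \<in> {2..<d + 3}"
  shows "\<exists>i\<in>{2..m}. X i = [l]"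
  using assms(4-)
proof (induction m arbitrary: s')
  case (Suc m)
  have ne: "lambda_word A B X m \<noteq> []" "rho_word A B X m \<noteq> []"
    using length_lambda_rho_word[OF assms(1,2), of m X] by auto
  note desc = top_descent[OF Suc.prems(2,3)[unfolded lambda_rho_word_Suc] ne]
  \<comment> \<open>The parameter at the current level is nonempty, so the level is not 1.\<close>
  then have m: "1 \<le> m" using assms(3) by (cases m) auto
  from desc consider
    "((s, 0), (\<not> s', ell (Suc d))) \<in> run d (lambda_word A B X m)"
      "((\<not> s, 0), (s', ell (Suc d))) \<in> run d (rho_word A B X m)"
    | "lambda_word A B X m = nt_word s d" "rho_word A B X m = nt_word (\<not> s) d" "X (Suc m) = [d + 2]"
    by blast
  then show ?case
  proof cases
    case 1
    then have "\<exists>i\<in>{2..m}. X i = [l]" using Suc.IH[of "\<not> s'"] m assms(7) by simp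
    then show ?thesis by auto
  next
    case 2
    show ?thesis
    proof (cases "l = d + 2")
      case True
      then have "X (Suc m) = [l]" "Suc m \<in> {2..Suc m}" using 2(3) m by simp_all
      then show ?thesis by blast
    next
      case False
      then have "\<exists>i\<in>{2..m}. X i = [l]"
        using letters_of_nt_word[OF assms(1-3) m 2(1,2), of l] assms(7) by simp
      then show ?thesis by auto
    qed
  qed
qed simp

text \<open>After \<open>ell d\<close> levels the words are too long to be readable from two
  vertices. The next two parameters supply the transitions required by \<open>loop_states\<close>,
  and the third makes both relations empty as soon as one of \<open>L\<close> and \<open>R\<close>
  acts emptily.\<close>

lemma letters_of_long_words:
  assumes "A \<noteq> []" "B \<noteq> []" "X 1 = []"
    and N: "N = ell d + 3"
    and neq: "run d (lambda_word A B X N) \<noteq> run d (rho_word A B X N)"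
    and "l \<in> {2..<d + 3}"
  shows "\<exists>i\<in>{2..N}. X i = [l]"
proof -
  define m where "m = ell d"
  define U where "U = lambda_word A B X m"
  define V where "V = rho_word A B X m"
  define x where "x = X (Suc m)"
  define y where "y = X (Suc (Suc m))"
  define z where "z = X (Suc (Suc (Suc m)))"
  have N: "N = Suc (Suc (Suc m))" using N m_def by simp
  define L where "L = U @ x @ V @ y @ V @ x @ U"
  define R where "R = V @ x @ U @ y @ U @ x @ V"
  have eqs: "lambda_word A B X N = L @ z @ R" "rho_word A B X N = R @ z @ L"
    unfolding N lambda_rho_word_Suc L_def R_def by (simp_all add: U_def V_def x_def y_def z_def)
  have nempty: "run d L \<noteq> {}" "run d R \<noteq> {}"
    using neq unfolding eqs run_append by blast+
  have len: "ell d < length U" "ell d < length V"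
    using length_lambda_rho_word[OF assms(1,2), of m X] by (auto simp: U_def V_def m_def)
  have "run d U \<noteq> {}" "run d V \<noteq> {}"
    using nempty(1) unfolding L_def run_append by blast+
  then obtain i a j b where ia: "(i, a) \<in> run d U" and jb: "(j, b) \<in> run d V" by auto
  have U: "run d U = {(i, a)}"
    using ia by (intro equalityI subrelI) (auto dest: long_run_unique[OF ia _ len(1)])
  have V: "run d V = {(j, b)}"
    using jb by (intro equalityI subrelI) (auto dest: long_run_unique[OF jb _ len(2)])
  have "(i, a) \<noteq> (j, b)"
  proof
    assume "(i, a) = (j, b)"
    then have "run d U = run d V" using U V by simp
    then show False using neq unfolding eqs L_def R_def run_append by simp
  qed
  moreover have "(a, j) \<in> run d x" "(b, i) \<in> run d x" "(b, j) \<in> run d y"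
    using nempty(1) unfolding L_def run_append U V by blast+
  moreover have "(a, i) \<in> run d y"
    using nempty(2) unfolding R_def run_append U V by blast
  ultimately obtain s s' where "i = (s, 0)" "j = (\<not> s, 0)" "a = (s', ell (Suc d))" "b = (\<not> s', ell (Suc d))"
    using loop_states by metis
  then have "\<exists>i\<in>{2..m}. X i = [l]"
    using letters_of_loop[where A = A and B = B and X = X and m = m and s = s and s' = s' and d = d and l = l]
      assms(1-3,6) ia jb ell_ge_2[of d]
    unfolding U_def V_def m_def by simp
  then show ?thesis using N by auto
qed

text \<open>The parameters 2 to \<open>d + 2\<close> build the two path labels. From then on the
  ends reached are exchanged at every level, so the letters \<open>d + 3\<close> (switching paths)
  and \<open>d + 4\<close> alternate.\<close>

definition loop_letters :: "nat \<Rightarrow> nat \<Rightarrow> nat list" where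
  "loop_letters d i =
     (if i \<le> 1 then [] else if i \<le> d + 2 then [i] else if even (i - d) then [d + 4] else [d + 3])"

lemma loop_words_nt_word:
  "k \<le> Suc d \<Longrightarrow> lambda_word [0] [1] (loop_letters d) (Suc k) = nt_word False k \<and>
    rho_word [0] [1] (loop_letters d) (Suc k) = nt_word True k"
proof (induction k)
  case 0
  show ?case by (simp add: lambda_rho_word_Suc loop_letters_def)
next
  case (Suc k)
  have "loop_letters d (Suc (Suc k)) = [k + 2]" using Suc.prems by (simp add: loop_letters_def)
  then show ?case
    using Suc lambda_rho_word_Suc[of "[0]" "[1]" "loop_letters d" "Suc k"] by simp
qed

lemma loop_words_run:
  "((False, 0), (odd m, ell (Suc d))) \<in> run d (lambda_word [0] [1] (loop_letters d) (Suc (Suc d) + m)) \<and>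
   ((True, 0), (even m, ell (Suc d))) \<in> run d (rho_word [0] [1] (loop_letters d) (Suc (Suc d) + m))"
proof (induction m)
  case 0
  show ?case
    using run_nt_word[of False d] run_nt_word[of True d] loop_words_nt_word[of "Suc d" d]
    by (simp del: nt_word.simps ell_Suc)
next
  case (Suc m)
  let ?x = "loop_letters d (Suc (Suc (Suc d) + m))"
  have x: "?x = (if odd m then [d + 4] else [d + 3])"
    by (auto simp: loop_letters_def)
  have "((odd m, ell (Suc d)), (True, 0)) \<in> run d ?x \<and> ((even m, ell (Suc d)), (False, 0)) \<in> run d ?x"
    unfolding x by (cases "odd m") (auto simp: edge_def)
  then have "((False, 0), (even m, ell (Suc d))) \<in> run d (lambda_word [0] [1] (loop_letters d) (Suc (Suc (Suc d) + m))) \<and>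
   ((True, 0), (odd m, ell (Suc d))) \<in> run d (rho_word [0] [1] (loop_letters d) (Suc (Suc (Suc d) + m)))"
    using Suc unfolding lambda_rho_word_Suc run_append by blast
  then show ?case by simp
qed

text \<open>Only the letter 0 leaves \<open>(False, 0)\<close>, so the second word, which begins
  with 1, cannot be read there, whereas the first can.\<close>

lemma loop_words_neq:
  "run d (lambda_word [0] [1] (loop_letters d) (Suc (Suc d) + m)) \<noteq>
   run d (rho_word [0] [1] (loop_letters d) (Suc (Suc d) + m))"
proof
  let ?L = "lambda_word [0] [1] (loop_letters d) (Suc (Suc d) + m)"
  let ?R = "rho_word [0] [1] (loop_letters d) (Suc (Suc d) + m)"
  assume eq: "run d ?L = run d ?R"
  have "(\<exists>w. lambda_word [0] [1] X k = 0 # w) \<and> (\<exists>w. rho_word [0] [1] X k = 1 # w)" for X k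
    by (induction k) (auto simp: lambda_rho_word_Suc)
  then obtain w w' where w: "?L = 0 # w" "?R = 1 # w'"
    by metis
  have letter: "nt_word False (Suc d) ! 0 = y" if "((False, 0), q) \<in> edge d y" for q y
    using that
  proof (cases rule: edge_cases)
    case (path s t)
    then show ?thesis by (simp del: nt_word.simps)
  qed (use ell_ge_2[of "Suc d"] in auto)
  have "((False, 0), (odd m, ell (Suc d))) \<in> run d ?L" using loop_words_run by blast
  then have "nt_word False (Suc d) ! 0 = 0" unfolding w(1) using letter by (auto simp del: nt_word.simps)
  moreover have "((False, 0), (odd m, ell (Suc d))) \<in> run d ?R"
    using loop_words_run[of m d] eq by blast
  then have "nt_word False (Suc d) ! 0 = 1" unfolding w(2) using letter by (auto simp del: nt_word.simps)
  ultimately show False by simp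
qed

section \<open>The semigroup of path relations\<close>

definition states :: "nat \<Rightarrow> (bool \<times> nat) set" where
  "states d = UNIV \<times> {..ell (Suc d)}"

lemma edge_subset: "edge d x \<subseteq> states d \<times> states d"
proof (rule subrelI)
  fix p q assume "(p, q) \<in> edge d x"
  then show "(p, q) \<in> states d \<times> states d"
    by (cases rule: edge_cases) (simp_all add: states_def del: ell_Suc)
qed

lemma run_subset: "w \<noteq> [] \<Longrightarrow> run d w \<subseteq> states d \<times> states d"
proof (induction w rule: list_nonempty_induct)
  case (single x)
  then show ?case using edge_subset by simp
next
  case (cons x w)
  then show ?case using edge_subset[of d x] unfolding run.simps by blast
qed

lemma finite_runs: "finite (run d ` {w. w \<noteq> []})"
proof (rule finite_subset)
  show "run d ` {w. w \<noteq> []} \<subseteq> Pow (states d \<times> states d)"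
    using run_subset by blast
qed (simp add: states_def)

lemma letter_edge:
  assumes "l \<in> {2..<d + 3}"
  obtains t where "t < ell (Suc d)" "nt_word s (Suc d) ! t = l" "((s, t), (s, Suc t)) \<in> run d [l]"
proof -
  have "l \<in> set (nt_word s (Suc d))" using assms unfolding set_nt_word by simp
  then obtain t where t: "t < ell (Suc d)" "nt_word s (Suc d) ! t = l"
    unfolding in_set_conv_nth length_nt_word by blast
  then have "((s, t), (s, Suc t)) \<in> run d [l]"
    unfolding edge_def run.simps R_O_Id by (intro UnI1) auto
  then show ?thesis by (rule that[OF t])
qed

text \<open>The letter occurs on both paths, so an equivalent word is readable from two vertices; it
  is then a single letter or moves each vertex by its own length, which exceeds 1.\<close>

lemma run_letter_irreducible:
  assumes "l \<in> {2..<d + 3}" "u \<noteq> []" "v \<noteq> []"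
  shows "run d [l] \<noteq> run d (u @ v)"
proof
  assume eq: "run d [l] = run d (u @ v)"
  obtain t where t: "((False, t), (False, Suc t)) \<in> run d (u @ v)"
    using letter_edge[OF assms(1), of False] unfolding eq by blast
  obtain t' where t': "((True, t'), (True, Suc t')) \<in> run d (u @ v)"
    using letter_edge[OF assms(1), of True] unfolding eq by blast
  have len: "length (u @ v) \<noteq> 1" using assms(2,3) by (cases u; cases v) auto
  have "(False, t) \<noteq> (True, t')" by simp
  with t t' show False
  proof (cases rule: two_runs_cases)
    case small
    then have "(False, Suc t) = (False, t + length (u @ v))" by (rule small_run(1)[OF t])
    then show ?thesis using len unfolding prod.inject by linarith
  next
    case (big x)
    then have "length (u @ v) = 1" by simp
    then show ?thesis using len by blast
  qed
qed

lemma run_letter_inject: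
  assumes "l \<in> {2..<d + 3}" "run d [l] = run d [l']"
  shows "l = l'"
proof -
  obtain t where t: "nt_word False (Suc d) ! t = l" and "((False, t), (False, Suc t)) \<in> run d [l]"
    using letter_edge[OF assms(1), of False] by blast
  then have "((False, t), (False, Suc t)) \<in> edge d l'" unfolding assms(2) by simp
  then show ?thesis by (cases rule: edge_cases) (use t in \<open>simp_all del: nt_word.simps\<close>)
qed

text \<open>The quotient of the nonempty words by the kernel of \<open>r\<close>. Its finitely many
  classes are numbered in order to get a carrier of natural numbers.\<close>

lemma semigroup_of_words:
  fixes r :: "'a list \<Rightarrow> 'b"
  assumes fin: "finite (r ` {w. w \<noteq> []})"
    and cong: "\<And>u u' v v'. r u = r u' \<Longrightarrow> r v = r v' \<Longrightarrow> r (u @ v) = r (u' @ v')"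
  obtains S :: "nat semigrp" and h where "finite_semigroup S" "carrier S = h ` {w. w \<noteq> []}"
    "\<And>u v. u \<noteq> [] \<Longrightarrow> v \<noteq> [] \<Longrightarrow> h u \<cdot>\<^bsub>S\<^esub> h v = h (u @ v)"
    "\<And>u v. u \<noteq> [] \<Longrightarrow> v \<noteq> [] \<Longrightarrow> h u = h v \<longleftrightarrow> r u = r v"
proof -
  obtain f :: "'b \<Rightarrow> nat" where f: "inj_on f (r ` {w. w \<noteq> []})"
    using finite_imp_inj_to_nat_seg[OF fin] by blast
  define h where "h w = f (r w)" for w
  define rep where "rep x = (SOME w. w \<noteq> [] \<and> h w = x)" for x
  define S :: "nat semigrp" where
    "S = \<lparr>carrier = h ` {w. w \<noteq> []}, sgmult = (\<lambda>x y. h (rep x @ rep y))\<rparr>"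
  have h_eq: "h u = h v \<longleftrightarrow> r u = r v" if "u \<noteq> []" "v \<noteq> []" for u v
    using inj_on_eq_iff[OF f] that by (simp add: h_def)
  have rep: "rep (h u) \<noteq> [] \<and> h (rep (h u)) = h u" if "u \<noteq> []" for u
    unfolding rep_def by (rule someI) (use that in simp)
  have mult: "h u \<cdot>\<^bsub>S\<^esub> h v = h (u @ v)" if "u \<noteq> []" "v \<noteq> []" for u v
  proof -
    have "r (rep (h u)) = r u" "r (rep (h v)) = r v"
      using rep[OF that(1)] rep[OF that(2)] h_eq[OF _ that(1)] h_eq[OF _ that(2)] by blast+
    then have "r (rep (h u) @ rep (h v)) = r (u @ v)" by (rule cong)
    then show ?thesis by (simp add: S_def h_def)
  qed
  have carr: "carrier S = h ` {w. w \<noteq> []}" by (simp add: S_def)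
  have "carrier S = f ` r ` {w. w \<noteq> []}" unfolding carr h_def by blast
  then have "finite (carrier S)" using fin by simp
  moreover have "is_semigroup S"
    unfolding is_semigroup_def carr by (auto simp: mult)
  ultimately have "finite_semigroup S" unfolding finite_semigroup_def by blast
  then show ?thesis by (rule that[OF _ carr mult h_eq])
qed

section \<open>Neumann--Taylor semigroups of words\<close>

text \<open>The empty word goes to \<open>None\<close>, which is neutral for \<open>opt_mult\<close>
  even when it is not in the carrier of \<open>adjoin_one\<close>.\<close>

definition opt_word :: "(nat list \<Rightarrow> 'a) \<Rightarrow> nat list \<Rightarrow> 'a option" where
  "opt_word h w = (if w = [] then None else Some (h w))"

lemma sgmult_adjoin_one [simp]: "sgmult (adjoin_one M) = opt_mult (sgmult M)"
  by (simp add: adjoin_one_def)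

lemma nt_opt_word:
  assumes mult: "\<And>u v. u \<noteq> [] \<Longrightarrow> v \<noteq> [] \<Longrightarrow> h u \<cdot>\<^bsub>M\<^esub> h v = h (u @ v)"
    and ne: "A \<noteq> []" "B \<noteq> []"
  shows "nt_lambda (adjoin_one M) (Some (h A)) (Some (h B)) (opt_word h \<circ> X) m = Some (h (lambda_word A B X m)) \<and>
    nt_rho (adjoin_one M) (Some (h A)) (Some (h B)) (opt_word h \<circ> X) m = Some (h (rho_word A B X m))"
proof (induction m)
  case (Suc m)
  have "lambda_word A B X m \<noteq> []" "rho_word A B X m \<noteq> []"
    using length_lambda_rho_word[OF ne, of m X] by auto
  then show ?case using Suc
    by (simp add: nt_lambda.simps(2)[of "adjoin_one M"] nt_rho.simps(2)[of "adjoin_one M"]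
        lambda_rho_word_Suc opt_word_def mult)
qed simp

lemma nt_cong:
  assumes "\<And>i. i \<in> {1..m} \<Longrightarrow> z i = z' i"
  shows "nt_lambda M x y z m = nt_lambda M x y z' m \<and> nt_rho M x y z m = nt_rho M x y z' m"
  using assms by (induction m) (auto simp: nt_lambda.simps(2) nt_rho.simps(2))

lemma adjoined_one_neutral:
  assumes "a \<in> carrier T"
  shows "opt_mult (sgmult T) (Some a) (adjoined_one T) = Some a"
proof (cases "\<exists>e. is_identity T e")
  case True
  have "e = e'" if "is_identity T e" "is_identity T e'" for e e'
    using that unfolding is_identity_def by metis
  then have "is_identity T (THE e. is_identity T e)"
    using True by (metis (mono_tags) theI)
  moreover have "adjoined_one T = Some (THE e. is_identity T e)"
    using True by (simp add: adjoined_one_def)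
  ultimately show ?thesis using assms unfolding is_identity_def by simp
qed (simp add: adjoined_one_def)

text \<open>The first parameter enters only at level 1, between \<open>a\<close> and
  \<open>b\<close>, where a genuine identity of \<open>T\<close> has the same effect as
  \<open>None\<close>.\<close>

lemma nt_adjoined_one:
  assumes "a \<in> carrier T" "b \<in> carrier T" "c 1 = adjoined_one T"
  shows "nt_lambda (adjoin_one T) (Some a) (Some b) c (Suc m) =
      nt_lambda (adjoin_one T) (Some a) (Some b) (c(1 := None)) (Suc m) \<and>
    nt_rho (adjoin_one T) (Some a) (Some b) c (Suc m) =
      nt_rho (adjoin_one T) (Some a) (Some b) (c(1 := None)) (Suc m)"
proof (induction m)
  case 0
  show ?case using assms adjoined_one_neutral[of _ T]
    by (simp add: nt_lambda.simps(2) nt_rho.simps(2))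
next
  case (Suc m)
  then show ?case
    by (simp add: nt_lambda.simps(2)[of _ _ _ _ "Suc m"] nt_rho.simps(2)[of _ _ _ _ "Suc m"])
qed

lemma run_eq_mono:
  assumes "m \<le> m'" "run d (lambda_word A B X m) = run d (rho_word A B X m)"
  shows "run d (lambda_word A B X m') = run d (rho_word A B X m')"
  using assms by (induction rule: dec_induct) (auto simp: lambda_rho_word_Suc run_append)

section \<open>The path semigroup and its subsemigroups\<close>

locale path_semigroup =
  fixes d :: nat and S :: "nat semigrp" and h :: "nat list \<Rightarrow> nat"
  assumes finite_semigroup: "finite_semigroup S"
    and carrier_eq: "carrier S = h ` {w. w \<noteq> []}"
    and mult: "\<And>u v. u \<noteq> [] \<Longrightarrow> v \<noteq> [] \<Longrightarrow> h u \<cdot>\<^bsub>S\<^esub> h v = h (u @ v)"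
    and h_eq_iff: "\<And>u v. u \<noteq> [] \<Longrightarrow> v \<noteq> [] \<Longrightarrow> h u = h v \<longleftrightarrow> run d u = run d v"
begin

lemma not_neumann_taylor: "\<not> neumann_taylor S"
proof
  assume "neumann_taylor S"
  then obtain n where n: "2 \<le> n" and
    eq: "\<And>a b c. a \<in> carrier S \<Longrightarrow> b \<in> carrier S \<Longrightarrow> c 1 = adjoined_one S \<Longrightarrow>
      (\<forall>i\<in>{2..n}. c i \<in> carrier (adjoin_one S)) \<Longrightarrow>
      nt_lambda (adjoin_one S) (Some a) (Some b) c n = nt_rho (adjoin_one S) (Some a) (Some b) c n"
    unfolding neumann_taylor_def by blast
  define X where "X = loop_letters d"
  \<comment> \<open>The value at 1 is overwritten because \<open>S\<close> might have an identity of
    its own; \<open>nt_adjoined_one\<close> changes it back to \<open>None\<close>.\<close>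
  define c where "c = (opt_word h \<circ> X)(1 := adjoined_one S)"
  have X1: "(opt_word h \<circ> X) 1 = None" by (simp add: X_def loop_letters_def opt_word_def)
  have c_1: "c 1 = adjoined_one S" by (simp add: c_def)
  have ab: "h [0] \<in> carrier S" "h [1] \<in> carrier S" by (simp_all add: carrier_eq)
  have "c i \<in> carrier (adjoin_one S)" if "i \<in> {2..n}" for i
  proof -
    have "X i \<noteq> []" using that by (auto simp: X_def loop_letters_def)
    then have "c i = Some (h (X i))" "h (X i) \<in> carrier S"
      using that by (simp_all add: c_def opt_word_def carrier_eq)
    then show ?thesis by (simp add: adjoin_one_def)
  qed
  then have "nt_lambda (adjoin_one S) (Some (h [0])) (Some (h [1])) c n =
    nt_rho (adjoin_one S) (Some (h [0])) (Some (h [1])) c n"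
    using eq[OF ab, of c] c_1 by blast
  moreover have "c(1 := None) = opt_word h \<circ> X"
    using X1 by (simp add: c_def fun_upd_idem)
  moreover obtain n' where "n = Suc n'" using n by (cases n) auto
  ultimately have "nt_lambda (adjoin_one S) (Some (h [0])) (Some (h [1])) (opt_word h \<circ> X) n =
    nt_rho (adjoin_one S) (Some (h [0])) (Some (h [1])) (opt_word h \<circ> X) n"
    using nt_adjoined_one[OF ab, of c n'] c_1 by metis
  then have "h (lambda_word [0] [1] X n) = h (rho_word [0] [1] X n)"
    using nt_opt_word[where h = h and M = S and A = "[0]" and B = "[1]" and X = X and m = n, OF mult]
    by (metis list.distinct(1) option.inject)
  moreover have "lambda_word [0] [1] X n \<noteq> []" "rho_word [0] [1] X n \<noteq> []"
    using length_lambda_rho_word[of "[0]" "[1]" n X] by auto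
  ultimately have "run d (lambda_word [0] [1] X n) = run d (rho_word [0] [1] X n)"
    using h_eq_iff by blast
  \<comment> \<open>The words of \<open>loop_letters\<close> are compared from level
    \<open>d + 2\<close> on, so the equality at level \<open>n\<close> is carried upwards.\<close>
  then have "run d (lambda_word [0] [1] X (Suc (Suc d) + n)) = run d (rho_word [0] [1] X (Suc (Suc d) + n))"
    by (rule run_eq_mono[rotated]) simp
  then show False using loop_words_neq unfolding X_def by blast
qed

text \<open>Lift elements and parameters to words. If the identity failed at level
  \<open>ell d + 3\<close>, then \<open>letters_of_long_words\<close> would exhibit
  \<open>[l]\<close> among the parameters, hence \<open>h [l]\<close> in \<open>T\<close>.\<close>

lemma neumann_taylor_without_letter:
  assumes T: "T \<subseteq> carrier S" and l: "l \<in> {2..<d + 3}" "h [l] \<notin> T"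
  shows "neumann_taylor (S\<lparr>carrier := T\<rparr>)" (is "neumann_taylor ?T")
  unfolding neumann_taylor_def
proof (intro exI[of _ "ell d + 3"] conjI ballI allI impI)
  let ?n = "ell d + 3"
  show "2 \<le> ?n" by simp
  fix a b c
  assume ab: "a \<in> carrier ?T" "b \<in> carrier ?T"
    and c: "c 1 = adjoined_one ?T \<and> (\<forall>i\<in>{2..?n}. c i \<in> carrier (adjoin_one ?T))"
  obtain A B where A: "a = h A" "A \<noteq> []" and B: "b = h B" "B \<noteq> []"
  proof -
    have "a \<in> h ` {w. w \<noteq> []}" "b \<in> h ` {w. w \<noteq> []}" using ab T carrier_eq by auto
    then show ?thesis using that by blast
  qed
  have "\<exists>w. c i = opt_word h w" if "i \<in> {2..?n}" for i
  proof -
    have "c i \<in> insert None (Some ` T)"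
      using c that by (auto simp: adjoin_one_def split: if_splits)
    show ?thesis
    proof (cases "c i")
      case None
      then have "c i = opt_word h []" by (simp add: opt_word_def)
      then show ?thesis ..
    next
      case (Some x)
      then have "x \<in> h ` {w. w \<noteq> []}" using \<open>c i \<in> _\<close> T carrier_eq by auto
      then obtain w where "w \<noteq> []" "x = h w" by blast
      then have "c i = opt_word h w" using Some by (simp add: opt_word_def)
      then show ?thesis ..
    qed
  qed
  then obtain W where W: "\<And>i. i \<in> {2..?n} \<Longrightarrow> c i = opt_word h (W i)" by metis
  define X where "X = W(1 := [])"
  have "(c(1 := None)) i = (opt_word h \<circ> X) i" if "i \<in> {1..?n}" for i
    using W[of i] that by (cases "i = 1") (auto simp: X_def opt_word_def)
  then have nt: "nt_lambda M x y (c(1 := None)) ?n = nt_lambda M x y (opt_word h \<circ> X) ?n \<and>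
    nt_rho M x y (c(1 := None)) ?n = nt_rho M x y (opt_word h \<circ> X) ?n" for M x y
    by (rule nt_cong)
  have n: "?n = Suc (ell d + 2)" by simp
  have mult': "h u \<cdot>\<^bsub>?T\<^esub> h v = h (u @ v)" if "u \<noteq> []" "v \<noteq> []" for u v
    using mult[OF that] by simp
  have "nt_lambda (adjoin_one ?T) (Some a) (Some b) c ?n = nt_lambda (adjoin_one ?T) (Some a) (Some b) (c(1 := None)) ?n"
    "nt_rho (adjoin_one ?T) (Some a) (Some b) c ?n = nt_rho (adjoin_one ?T) (Some a) (Some b) (c(1 := None)) ?n"
    using nt_adjoined_one[OF ab, of c "ell d + 2"] c unfolding n by blast+
  moreover have "nt_lambda (adjoin_one ?T) (Some a) (Some b) (opt_word h \<circ> X) ?n = Some (h (lambda_word A B X ?n))"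
    "nt_rho (adjoin_one ?T) (Some a) (Some b) (opt_word h \<circ> X) ?n = Some (h (rho_word A B X ?n))"
    using nt_opt_word[where h = h and M = ?T and A = A and B = B and X = X and m = ?n, OF mult' A(2) B(2)]
    unfolding A(1) B(1) by blast+
  ultimately have *: "nt_lambda (adjoin_one ?T) (Some a) (Some b) c ?n = Some (h (lambda_word A B X ?n))"
    "nt_rho (adjoin_one ?T) (Some a) (Some b) c ?n = Some (h (rho_word A B X ?n))"
    using nt by metis+
  have "run d (lambda_word A B X ?n) = run d (rho_word A B X ?n)"
  proof (rule ccontr)
    assume neq: "\<not> ?thesis"
    have "X 1 = []" by (simp add: X_def)
    then obtain i where i: "i \<in> {2..?n}" "X i = [l]"
      using letters_of_long_words[OF A(2) B(2) _ refl neq l(1)] by blast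
    then have "c i = Some (h [l])" using W[of i] by (auto simp: X_def opt_word_def split: if_splits)
    then have "Some (h [l]) \<in> carrier (adjoin_one ?T)" using c i(1) by metis
    then show False using l(2) by (auto simp: adjoin_one_def split: if_splits)
  qed
  moreover have "lambda_word A B X ?n \<noteq> []" "rho_word A B X ?n \<noteq> []"
    using length_lambda_rho_word[OF A(2) B(2), of ?n X] by auto
  ultimately show "nt_lambda (adjoin_one ?T) (Some a) (Some b) c ?n =
    nt_rho (adjoin_one ?T) (Some a) (Some b) c ?n"
    unfolding * using h_eq_iff by simp
qed

lemma letter_notin_generated:
  assumes l: "l \<in> {2..<d + 3}" and "h [l] \<notin> A" and sub: "sg_generated S A \<subseteq> carrier S"
  shows "h [l] \<notin> sg_generated S A"
proof
  assume "h [l] \<in> sg_generated S A"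
  then show False
  proof cases
    case (mult a b)
    then obtain u v where "a = h u" "b = h v" "u \<noteq> []" "v \<noteq> []"
      using sub carrier_eq by blast
    then have "h [l] = h (u @ v)" using mult path_semigroup.mult[OF path_semigroup_axioms] by simp
    then have "run d [l] = run d (u @ v)" using h_eq_iff[of "[l]" "u @ v"] \<open>u \<noteq> []\<close> by simp
    then show False using run_letter_irreducible l \<open>u \<noteq> []\<close> \<open>v \<noteq> []\<close> by blast
  qed (use assms(2) in simp)
qed

text \<open>The \<open>d + 1\<close> letters of the parameters have distinct images, too many for
  \<open>A\<close>.\<close>

lemma generators_miss_letter:
  assumes "finite A" "card A \<le> d"
  shows "\<exists>l\<in>{2..<d + 3}. h [l] \<notin> A"
proof (rule ccontr)
  assume "\<not> ?thesis"
  then have "(\<lambda>l. h [l]) ` {2..<d + 3} \<subseteq> A" by blast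
  moreover have "inj_on (\<lambda>l. h [l]) {2..<d + 3}"
  proof (rule inj_onI)
    fix l l' assume l: "l \<in> {2..<d + 3}" and "h [l] = h [l']"
    then have "run d [l] = run d [l']" using h_eq_iff[of "[l]" "[l']"] by simp
    then show "l = l'" by (rule run_letter_inject[OF l])
  qed
  ultimately have "card {2..<d + 3} \<le> card A" using assms(1) card_inj_on_le by blast
  then show False using assms(2) by simp
qed

end

section \<open>The rank of \<open>NT\<close>\<close>

lemma finite_semigroup_subsemigroup:
  assumes "finite_semigroup S" "is_subsemigroup T S"
  shows "finite_semigroup (S\<lparr>carrier := T\<rparr>)"
  using assms unfolding finite_semigroup_def is_semigroup_def is_subsemigroup_def
  by (auto intro: finite_subset simp: subset_iff)

lemma infinite_rank_NT: "infinite_rank (NT :: nat semigrp set)"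
  unfolding infinite_rank_def
proof
  assume "\<exists>d. rank_at_most d (NT :: nat semigrp set)"
  then obtain d where rank: "rank_at_most d (NT :: nat semigrp set)" ..
  have cong: "run d (u @ v) = run d (u' @ v')" if "run d u = run d u'" "run d v = run d v'" for u u' v v'
    using that by (simp add: run_append)
  obtain S :: "nat semigrp" and h where "path_semigroup d S h"
  proof (rule semigroup_of_words[OF finite_runs[of d] cong])
    fix S :: "nat semigrp" and h
    assume "finite_semigroup S" "carrier S = h ` {w. w \<noteq> []}"
      "\<And>u v. u \<noteq> [] \<Longrightarrow> v \<noteq> [] \<Longrightarrow> h u \<cdot>\<^bsub>S\<^esub> h v = h (u @ v)"
      "\<And>u v. u \<noteq> [] \<Longrightarrow> v \<noteq> [] \<Longrightarrow> h u = h v \<longleftrightarrow> run d u = run d v"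
    then have "path_semigroup d S h" by unfold_locales
    then show ?thesis by (rule that)
  qed
  then interpret path_semigroup d S h .
  have "S\<lparr>carrier := T\<rparr> \<in> NT" if T: "is_subsemigroup T S" "n_generated d (S\<lparr>carrier := T\<rparr>)" for T
  proof -
    obtain A where A: "A \<subseteq> T" "finite A" "card A \<le> d" "sg_generated S A = T"
      using T(2) unfolding n_generated_def by auto
    have sub: "T \<subseteq> carrier S" using T(1) unfolding is_subsemigroup_def by blast
    obtain l where l: "l \<in> {2..<d + 3}" "h [l] \<notin> A" using generators_miss_letter A by blast
    then have "h [l] \<notin> T" using letter_notin_generated[OF l] A(4) sub by simp
    then show ?thesis
      using neumann_taylor_without_letter[OF sub l(1)] finite_semigroup_subsemigroup[OF finite_semigroup T(1)]
      unfolding NT_def by simp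
  qed
  then have "S \<in> NT" using rank finite_semigroup unfolding rank_at_most_def by blast
  then show False using not_neumann_taylor unfolding NT_def by simp
qed

theorem theorem6p1:
  shows "infinite_rank (NT :: nat semigrp set) \<and> \<not> finitely_based (NT :: nat semigrp set)"
  using infinite_rank_NT finitely_based_imp_finite_rank by blast

end
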